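(* Let $\pi:F\to M$ be a symmetric bundle. For $p\in M$ and $u\in F_p$ let $$\nu_u:=\sigma_{\frac u2}\circ\sigma_{0_p}\circ(-1)_F\circ\sigma_{\frac u2}$$ be the vertical symmetry with respect to $u$. Then the space $F$ together with the binary map $\nu:F\times F\to F$, $(v,w)\mapsto\nu_v(w)$, is a reflection space.
   Context: $\mathbb K$ is a commutative topological ring with dense unit group and with $2$ invertible (e.g. $\mathbb K=\mathbb R$); manifolds are smooth over $\mathbb K$, modelled on topological $\mathbb K$-modules. Here a map $f$ on an open set is $C^1$ if there is a continuous map $f^{[1]}$ with $f(x+tv)-f(x)=t\,f^{[1]}(x,v,t)$ whenever both sides are defined; $C^k$ and smoothness are defined inductively (for $\mathbb K=\mathbb R$ in finite dimension: the usual notions). **Reflection space.** A manifold $M$ with a smooth map $\mu:M\times M\to M$, $\mu(x,y)=:\sigma_x(y)$, such that for all $x,y,z\in M$: (S1) $\mu(x,x)=x$; (S2) $\mu(x,\mu(x,y))=y$; (S3) $\mu(x,\mu(y,z))=\mu(\mu(x,y),\mu(x,z))$. **Symmetric space.** A reflection space such that in addition (S4) $T_x(\sigma_x)=-\mathrm{id}_{T_xM}$ for all $x$. Homomorphisms are smooth maps commuting with product maps. **Symmetric bundle.** A vector bundle $\pi:F\to M$ such that (SB1) $(F,\mu)$ and $(M,\mu_M)$ are symmetric spaces and $\pi$ is a homomorphism of symmetric spaces; (SB2) for all $p,q\in M$ the induced map $F_p\oplus F_q\to F_{\mu_M(p,q)}$, $(v,w)\mapsto\mu(v,w)$ is linear.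 $\sigma_v=\mu(v,\cdot)$ denotes the symmetry of $F$ at $v\in F$; $0_p$ is the zero vector of $F_p$; $(-1)_F:F\to F$, $v\mapsto -v$ is the fiberwise multiplication by $-1$. *)

theory Defs
  imports "HOL-Analysis.Analysis"
begin

section \<open>Base ring and model modules\<close>

class dense_unit_ring = comm_ring_1 + topological_ab_group_add + topological_semigroup_mult +
  assumes dense_units: "open U \<Longrightarrow> U \<noteq> {} \<Longrightarrow> \<exists>a\<in>U. a dvd 1"
    and two_unit: "2 dvd 1"

definition half :: "'k::dense_unit_ring" where
  "half = (THE h. 2 * h = 1)"

text \<open>Model modules are Hausdorff, as always in this calculus: together with density of the units,
  this makes difference quotients, and hence differentials, unique.\<close>

definition topological_module ::
  "('k::dense_unit_ring \<Rightarrow> 'e \<Rightarrow> 'e::{topological_ab_group_add,t2_space}) \<Rightarrow> bool" where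
  "topological_module s \<longleftrightarrow> module s \<and> continuous_on UNIV (\<lambda>(a, x). s a x)"

section \<open>Differential calculus\<close>

text \<open>The domain of \<open>f\<^sup>[\<^sup>1\<^sup>]\<close> lies in \<open>E \<times> E \<times> K\<close>, so the inductive definition of \<open>C\<^sup>k\<close> changes the type
  of the domain in every step. To iterate inside one type, the modules
  \<open>E\<^sub>0 = E\<close> and \<open>E\<^sub>n\<^sub>+\<^sub>1 = E\<^sub>n \<times> E\<^sub>n \<times> K\<close> are all realised as sets of binary trees: \<open>E\<^sub>n\<close> is the set of
  full trees of depth \<open>n\<close>, with componentwise operations and the product topology.\<close>

datatype ('e, 'k) tower =
    Base (base: 'e)
  | Step (pt: "('e, 'k) tower") (dir: "('e, 'k) tower") (par: 'k)

fun tower_add :: "('e::ab_group_add, 'k::dense_unit_ring) tower \<Rightarrow> ('e, 'k) tower \<Rightarrow> ('e, 'k) tower"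
  where
    "tower_add (Base a) (Base b) = Base (a + b)"
  | "tower_add (Step x v t) (Step y w r) = Step (tower_add x y) (tower_add v w) (t + r)"
  | "tower_add _ _ = undefined"

primrec tower_scale ::
  "('k::dense_unit_ring \<Rightarrow> 'e \<Rightarrow> 'e) \<Rightarrow> 'k \<Rightarrow> ('e, 'k) tower \<Rightarrow> ('e, 'k) tower" where
  "tower_scale s a (Base x) = Base (s a x)"
| "tower_scale s a (Step x v t) = Step (tower_scale s a x) (tower_scale s a v) (a * t)"

primrec tower_top :: "nat \<Rightarrow> ('e::topological_space, 'k::dense_unit_ring) tower topology" where
  "tower_top 0 = pullback_topology (range Base) base euclidean"
| "tower_top (Suc n) =
     pullback_topology
       {Step x v t | x v t. x \<in> topspace (tower_top n) \<and> v \<in> topspace (tower_top n)}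
       (\<lambda>z. (pt z, dir z, par z))
       (prod_topology (tower_top n) (prod_topology (tower_top n) euclidean))"

text \<open>For \<open>D \<subseteq> E\<^sub>n\<close>, the set \<open>D\<^sup>[\<^sup>1\<^sup>] = {(x, v, t). x \<in> D \<and> x + t v \<in> D} \<subseteq> E\<^sub>n\<^sub>+\<^sub>1\<close>.\<close>

definition quotient_domain ::
  "('k::dense_unit_ring \<Rightarrow> 'e \<Rightarrow> 'e::{ab_group_add,topological_space})
    \<Rightarrow> nat \<Rightarrow> ('e, 'k) tower set \<Rightarrow> ('e, 'k) tower set" where
  "quotient_domain s n D =
     {Step x v t | x v t.
        x \<in> D \<and> v \<in> topspace (tower_top n) \<and> tower_add x (tower_scale s t v) \<in> D}"

text \<open>\<open>g'\<close> is a function \<open>g\<^sup>[\<^sup>1\<^sup>]\<close> for \<open>g : D \<rightarrow> F\<close>, where \<open>D \<subseteq> E\<^sub>n\<close>.\<close>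

definition difference_quotient ::
  "('k::dense_unit_ring \<Rightarrow> 'e \<Rightarrow> 'e::{ab_group_add,topological_space})
    \<Rightarrow> ('k \<Rightarrow> 'f \<Rightarrow> 'f::{ab_group_add,topological_space})
    \<Rightarrow> nat \<Rightarrow> ('e, 'k) tower set
    \<Rightarrow> (('e, 'k) tower \<Rightarrow> 'f) \<Rightarrow> (('e, 'k) tower \<Rightarrow> 'f) \<Rightarrow> bool" where
  "difference_quotient sE sF n D g g' \<longleftrightarrow>
     continuous_map (subtopology (tower_top (Suc n)) (quotient_domain sE n D)) euclidean g' \<and>
     (\<forall>x v t. Step x v t \<in> quotient_domain sE n D \<longrightarrow>
        g (tower_add x (tower_scale sE t v)) - g x = sF t (g' (Step x v t)))"

primrec tower_Ck ::
  "('k::dense_unit_ring \<Rightarrow> 'e \<Rightarrow> 'e::{ab_group_add,topological_space})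
    \<Rightarrow> ('k \<Rightarrow> 'f \<Rightarrow> 'f::{ab_group_add,topological_space})
    \<Rightarrow> nat \<Rightarrow> nat \<Rightarrow> ('e, 'k) tower set \<Rightarrow> (('e, 'k) tower \<Rightarrow> 'f) \<Rightarrow> bool" where
  "tower_Ck sE sF 0 n D g \<longleftrightarrow> continuous_map (subtopology (tower_top n) D) euclidean g"
| "tower_Ck sE sF (Suc k) n D g \<longleftrightarrow>
     (\<exists>g'. difference_quotient sE sF n D g g' \<and>
           tower_Ck sE sF k (Suc n) (quotient_domain sE n D) g')"

definition Ck_on ::
  "('k::dense_unit_ring \<Rightarrow> 'e \<Rightarrow> 'e::{ab_group_add,topological_space})
    \<Rightarrow> ('k \<Rightarrow> 'f \<Rightarrow> 'f::{ab_group_add,topological_space})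
    \<Rightarrow> nat \<Rightarrow> 'e set \<Rightarrow> ('e \<Rightarrow> 'f) \<Rightarrow> bool" where
  "Ck_on sE sF k U f \<longleftrightarrow> tower_Ck sE sF k 0 (Base ` U) (f \<circ> base)"

text \<open>Over a base ring that is not a field, a map that is \<open>C\<^sup>\<infinity>\<close> near every point of an open set need
  not be \<open>C\<^sup>\<infinity>\<close> on the whole set, since \<open>f\<^sup>[\<^sup>1\<^sup>] (x, v, t)\<close> with \<open>t\<close> a non-zero non-unit involves values
  of \<open>f\<close> at distant points. On manifolds, smoothness has to be local; over a field the two notions
  agree.\<close>

definition smooth_on ::
  "('k::dense_unit_ring \<Rightarrow> 'e \<Rightarrow> 'e::{ab_group_add,topological_space})
    \<Rightarrow> ('k \<Rightarrow> 'f \<Rightarrow> 'f::{ab_group_add,topological_space})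
    \<Rightarrow> 'e set \<Rightarrow> ('e \<Rightarrow> 'f) \<Rightarrow> bool" where
  "smooth_on sE sF U f \<longleftrightarrow>
     (\<forall>x\<in>U. \<exists>W. open W \<and> x \<in> W \<and> W \<subseteq> U \<and> (\<forall>k. Ck_on sE sF k W f))"

text \<open>\<open>df(x)v = f\<^sup>[\<^sup>1\<^sup>] (x, v, 0)\<close>, for \<open>f\<close> that is \<open>C\<^sup>1\<close> on a neighbourhood of \<open>x\<close>.\<close>

definition differential ::
  "('k::dense_unit_ring \<Rightarrow> 'e \<Rightarrow> 'e::{ab_group_add,topological_space})
    \<Rightarrow> ('k \<Rightarrow> 'f \<Rightarrow> 'f::{ab_group_add,topological_space})
    \<Rightarrow> ('e \<Rightarrow> 'f) \<Rightarrow> 'e \<Rightarrow> 'e \<Rightarrow> 'f" where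
  "differential sE sF f x v =
     (THE w. \<exists>W f'. open W \<and> x \<in> W \<and>
        difference_quotient sE sF 0 (Base ` W) (f \<circ> base) f' \<and>
        w = f' (Step (Base x) (Base v) 0))"

section \<open>Manifolds\<close>

record ('k, 'm, 'e) manifold_data =
  mtop :: "'m topology"
  atlas :: "('m set \<times> ('m \<Rightarrow> 'e)) set"
  mscale :: "'k \<Rightarrow> 'e \<Rightarrow> 'e"

abbreviation mspace :: "('k, 'm, 'e) manifold_data \<Rightarrow> 'm set" where
  "mspace M \<equiv> topspace (mtop M)"

definition is_chart ::
  "'m topology \<Rightarrow> 'm set \<times> ('m \<Rightarrow> 'e::topological_space) \<Rightarrow> bool" where
  "is_chart X c \<longleftrightarrow>
     openin X (fst c) \<and> open (snd c ` fst c) \<and>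
     homeomorphic_map (subtopology X (fst c)) (top_of_set (snd c ` fst c)) (snd c)"

definition chart_inv :: "'m set \<times> ('m \<Rightarrow> 'e) \<Rightarrow> 'e \<Rightarrow> 'm" where
  "chart_inv c = inv_into (fst c) (snd c)"

definition manifold ::
  "('k::dense_unit_ring, 'm, 'e::{topological_ab_group_add,t2_space}) manifold_data \<Rightarrow> bool" where
  "manifold M \<longleftrightarrow>
     topological_module (mscale M) \<and>
     (\<forall>c\<in>atlas M. is_chart (mtop M) c) \<and>
     (\<Union>c\<in>atlas M. fst c) = mspace M \<and>
     (\<forall>c\<in>atlas M. \<forall>d\<in>atlas M.
        smooth_on (mscale M) (mscale M) (snd c ` (fst c \<inter> fst d)) (snd d \<circ> chart_inv c))"

definition smooth_map ::
  "('k::dense_unit_ring, 'm, 'e::{ab_group_add,topological_space}) manifold_data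
    \<Rightarrow> ('k, 'n, 'f::{ab_group_add,topological_space}) manifold_data \<Rightarrow> ('m \<Rightarrow> 'n) \<Rightarrow> bool" where
  "smooth_map M N f \<longleftrightarrow>
     continuous_map (mtop M) (mtop N) f \<and>
     (\<forall>c\<in>atlas M. \<forall>d\<in>atlas N.
        smooth_on (mscale M) (mscale N) (snd c ` (fst c \<inter> f -` fst d)) (snd d \<circ> f \<circ> chart_inv c))"

definition diffeomorphism ::
  "('k::dense_unit_ring, 'm, 'e::{ab_group_add,topological_space}) manifold_data
    \<Rightarrow> ('k, 'n, 'f::{ab_group_add,topological_space}) manifold_data \<Rightarrow> ('m \<Rightarrow> 'n) \<Rightarrow> bool" where
  "diffeomorphism M N f \<longleftrightarrow>
     bij_betw f (mspace M) (mspace N) \<and> smooth_map M N f \<and>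
     smooth_map N M (inv_into (mspace M) f)"

definition prod_manifold ::
  "('k, 'm, 'e) manifold_data \<Rightarrow> ('k, 'n, 'f) manifold_data
    \<Rightarrow> ('k, 'm \<times> 'n, 'e \<times> 'f) manifold_data" where
  "prod_manifold M N =
     \<lparr>mtop = prod_topology (mtop M) (mtop N),
      atlas = {(fst c \<times> fst d, map_prod (snd c) (snd d)) | c d. c \<in> atlas M \<and> d \<in> atlas N},
      mscale = (\<lambda>a. map_prod (mscale M a) (mscale N a))\<rparr>"

definition open_submanifold ::
  "('k, 'm, 'e) manifold_data \<Rightarrow> 'm set \<Rightarrow> ('k, 'm, 'e) manifold_data" where
  "open_submanifold M U =
     \<lparr>mtop = subtopology (mtop M) U,
      atlas = {(fst c \<inter> U, snd c) | c. c \<in> atlas M},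
      mscale = mscale M\<rparr>"

definition module_manifold ::
  "('k \<Rightarrow> 'e \<Rightarrow> 'e::topological_space) \<Rightarrow> ('k, 'e, 'e) manifold_data" where
  "module_manifold s = \<lparr>mtop = euclidean, atlas = {(UNIV, id)}, mscale = s\<rparr>"

subsection \<open>Tangent spaces\<close>

text \<open>\<open>T\<^sub>pM\<close> consists of the classes \<open>[c, v]\<close> of pairs of a chart \<open>c\<close> at \<open>p\<close> and a vector \<open>v\<close> of the
  model module, where \<open>[c, v] = [d, w]\<close> if \<open>w = d(d \<circ> c\<^sup>-\<^sup>1)(c(p)) v\<close>.\<close>

definition charts_at :: "('k, 'm, 'e) manifold_data \<Rightarrow> 'm \<Rightarrow> ('m set \<times> ('m \<Rightarrow> 'e)) set" where
  "charts_at M p = {c \<in> atlas M. p \<in> fst c}"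

definition tangent_rel ::
  "('k::dense_unit_ring, 'm, 'e::{ab_group_add,topological_space}) manifold_data \<Rightarrow> 'm
    \<Rightarrow> ((('m set \<times> ('m \<Rightarrow> 'e)) \<times> 'e) \<times> (('m set \<times> ('m \<Rightarrow> 'e)) \<times> 'e)) set" where
  "tangent_rel M p =
     {((c, v), (d, w)) | c v d w. c \<in> charts_at M p \<and> d \<in> charts_at M p \<and>
        w = differential (mscale M) (mscale M) (snd d \<circ> chart_inv c) (snd c p) v}"

definition tangent_space ::
  "('k::dense_unit_ring, 'm, 'e::{ab_group_add,topological_space}) manifold_data \<Rightarrow> 'm
    \<Rightarrow> (('m set \<times> ('m \<Rightarrow> 'e)) \<times> 'e) set set" where
  "tangent_space M p = (charts_at M p \<times> UNIV) // tangent_rel M p"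

definition tangent_uminus :: "('c \<times> 'e::ab_group_add) set \<Rightarrow> ('c \<times> 'e) set" where
  "tangent_uminus \<xi> = {(c, - v) | c v. (c, v) \<in> \<xi>}"

definition tangent_map ::
  "('k::dense_unit_ring, 'm, 'e::{ab_group_add,topological_space}) manifold_data
    \<Rightarrow> ('k, 'n, 'f::{ab_group_add,topological_space}) manifold_data \<Rightarrow> ('m \<Rightarrow> 'n) \<Rightarrow> 'm
    \<Rightarrow> (('m set \<times> ('m \<Rightarrow> 'e)) \<times> 'e) set \<Rightarrow> (('n set \<times> ('n \<Rightarrow> 'f)) \<times> 'f) set" where
  "tangent_map M N f p \<xi> =
     {(d, differential (mscale M) (mscale N) (snd d \<circ> f \<circ> chart_inv c) (snd c p) v) | c v d.
        (c, v) \<in> \<xi> \<and> d \<in> charts_at N (f p)}"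

section \<open>Reflection spaces and symmetric spaces\<close>

definition reflection_space ::
  "('k::dense_unit_ring, 'm, 'e::{topological_ab_group_add,t2_space}) manifold_data
    \<Rightarrow> ('m \<Rightarrow> 'm \<Rightarrow> 'm) \<Rightarrow> bool" where
  "reflection_space M \<mu> \<longleftrightarrow>
     manifold M \<and> smooth_map (prod_manifold M M) M (\<lambda>(x, y). \<mu> x y) \<and>
     (\<forall>x\<in>mspace M. \<mu> x x = x) \<and>
     (\<forall>x\<in>mspace M. \<forall>y\<in>mspace M. \<mu> x (\<mu> x y) = y) \<and>
     (\<forall>x\<in>mspace M. \<forall>y\<in>mspace M. \<forall>z\<in>mspace M. \<mu> x (\<mu> y z) = \<mu> (\<mu> x y) (\<mu> x z))"

definition symmetric_space ::
  "('k::dense_unit_ring, 'm, 'e::{topological_ab_group_add,t2_space}) manifold_data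
    \<Rightarrow> ('m \<Rightarrow> 'm \<Rightarrow> 'm) \<Rightarrow> bool" where
  "symmetric_space M \<mu> \<longleftrightarrow>
     reflection_space M \<mu> \<and>
     (\<forall>x\<in>mspace M. \<forall>\<xi>\<in>tangent_space M x. tangent_map M M (\<mu> x) x \<xi> = tangent_uminus \<xi>)"

definition symmetric_hom ::
  "('k::dense_unit_ring, 'm, 'e::{ab_group_add,topological_space}) manifold_data
    \<Rightarrow> ('m \<Rightarrow> 'm \<Rightarrow> 'm)
    \<Rightarrow> ('k, 'n, 'f::{ab_group_add,topological_space}) manifold_data \<Rightarrow> ('n \<Rightarrow> 'n \<Rightarrow> 'n)
    \<Rightarrow> ('m \<Rightarrow> 'n) \<Rightarrow> bool" where
  "symmetric_hom M \<mu> N \<nu> f \<longleftrightarrow>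
     smooth_map M N f \<and> (\<forall>x\<in>mspace M. \<forall>y\<in>mspace M. f (\<mu> x y) = \<nu> (f x) (f y))"

section \<open>Vector bundles and symmetric bundles\<close>

record ('k, 'm, 'f) fibre_ops =
  fzero :: "'m \<Rightarrow> 'f"
  fadd :: "'f \<Rightarrow> 'f \<Rightarrow> 'f"
  fscale :: "'k \<Rightarrow> 'f \<Rightarrow> 'f"

definition fibre :: "('k, 'f, 'g) manifold_data \<Rightarrow> ('f \<Rightarrow> 'm) \<Rightarrow> 'm \<Rightarrow> 'f set" where
  "fibre F \<pi> p = {v \<in> mspace F. \<pi> v = p}"

definition module_on ::
  "'f set \<Rightarrow> 'f \<Rightarrow> ('f \<Rightarrow> 'f \<Rightarrow> 'f) \<Rightarrow> ('k::comm_ring_1 \<Rightarrow> 'f \<Rightarrow> 'f) \<Rightarrow> bool" where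
  "module_on S z add s \<longleftrightarrow>
     z \<in> S \<and>
     (\<forall>x\<in>S. \<forall>y\<in>S. add x y \<in> S \<and> add x y = add y x) \<and>
     (\<forall>x\<in>S. \<forall>y\<in>S. \<forall>w\<in>S. add (add x y) w = add x (add y w)) \<and>
     (\<forall>x\<in>S. add z x = x) \<and>
     (\<forall>x\<in>S. \<exists>y\<in>S. add x y = z) \<and>
     (\<forall>a. \<forall>x\<in>S. s a x \<in> S) \<and>
     (\<forall>a. \<forall>x\<in>S. \<forall>y\<in>S. s a (add x y) = add (s a x) (s a y)) \<and>
     (\<forall>a b. \<forall>x\<in>S. s (a + b) x = add (s a x) (s b x) \<and> s (a * b) x = s a (s b x)) \<and>
     (\<forall>x\<in>S. s 1 x = x)"

text \<open>\<open>\<Phi>\<close> identifies the part of the bundle over the open set \<open>U\<close> with \<open>U \<times> V\<close>, where \<open>sV\<close> is the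
  scalar multiplication of the typical fibre \<open>V\<close>.\<close>

definition local_trivialization ::
  "('k::dense_unit_ring \<Rightarrow> 'v \<Rightarrow> 'v::{ab_group_add,topological_space})
    \<Rightarrow> ('k, 'f, 'g::{ab_group_add,topological_space}) manifold_data
    \<Rightarrow> ('k, 'm, 'e::{ab_group_add,topological_space}) manifold_data
    \<Rightarrow> ('f \<Rightarrow> 'm) \<Rightarrow> ('k, 'm, 'f) fibre_ops \<Rightarrow> 'm set \<Rightarrow> ('f \<Rightarrow> 'm \<times> 'v) \<Rightarrow> bool" where
  "local_trivialization sV F M \<pi> B U \<Phi> \<longleftrightarrow>
     openin (mtop M) U \<and>
     diffeomorphism (open_submanifold F {v \<in> mspace F. \<pi> v \<in> U})
       (prod_manifold (open_submanifold M U) (module_manifold sV)) \<Phi> \<and>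
     (\<forall>p\<in>U. \<forall>v\<in>fibre F \<pi> p. fst (\<Phi> v) = p) \<and>
     (\<forall>p\<in>U. \<forall>v\<in>fibre F \<pi> p. \<forall>w\<in>fibre F \<pi> p.
        snd (\<Phi> (fadd B v w)) = snd (\<Phi> v) + snd (\<Phi> w)) \<and>
     (\<forall>p\<in>U. \<forall>a. \<forall>v\<in>fibre F \<pi> p. snd (\<Phi> (fscale B a v)) = sV a (snd (\<Phi> v)))"

definition vector_bundle ::
  "('k::dense_unit_ring \<Rightarrow> 'v \<Rightarrow> 'v::{topological_ab_group_add,t2_space})
    \<Rightarrow> ('k, 'f, 'g::{topological_ab_group_add,t2_space}) manifold_data
    \<Rightarrow> ('k, 'm, 'e::{topological_ab_group_add,t2_space}) manifold_data
    \<Rightarrow> ('f \<Rightarrow> 'm) \<Rightarrow> ('k, 'm, 'f) fibre_ops \<Rightarrow> bool" where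
  "vector_bundle sV F M \<pi> B \<longleftrightarrow>
     topological_module sV \<and> manifold F \<and> manifold M \<and> smooth_map F M \<pi> \<and>
     (\<forall>p\<in>mspace M. module_on (fibre F \<pi> p) (fzero B p) (fadd B) (fscale B)) \<and>
     (\<forall>p\<in>mspace M. \<exists>U \<Phi>. p \<in> U \<and> local_trivialization sV F M \<pi> B U \<Phi>)"

definition symmetric_bundle ::
  "('k::dense_unit_ring \<Rightarrow> 'v \<Rightarrow> 'v::{topological_ab_group_add,t2_space})
    \<Rightarrow> ('k, 'f, 'g::{topological_ab_group_add,t2_space}) manifold_data \<Rightarrow> ('f \<Rightarrow> 'f \<Rightarrow> 'f)
    \<Rightarrow> ('k, 'm, 'e::{topological_ab_group_add,t2_space}) manifold_data \<Rightarrow> ('m \<Rightarrow> 'm \<Rightarrow> 'm)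
    \<Rightarrow> ('f \<Rightarrow> 'm) \<Rightarrow> ('k, 'm, 'f) fibre_ops \<Rightarrow> bool" where
  "symmetric_bundle sV F \<mu> M \<mu>M \<pi> B \<longleftrightarrow>
     vector_bundle sV F M \<pi> B \<and>
     symmetric_space F \<mu> \<and> symmetric_space M \<mu>M \<and> symmetric_hom F \<mu> M \<mu>M \<pi> \<and>
     (\<forall>p\<in>mspace M. \<forall>q\<in>mspace M.
        (\<forall>v\<in>fibre F \<pi> p. \<forall>v'\<in>fibre F \<pi> p. \<forall>w\<in>fibre F \<pi> q. \<forall>w'\<in>fibre F \<pi> q.
           \<mu> (fadd B v v') (fadd B w w') = fadd B (\<mu> v w) (\<mu> v' w')) \<and>
        (\<forall>a. \<forall>v\<in>fibre F \<pi> p. \<forall>w\<in>fibre F \<pi> q.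
           \<mu> (fscale B a v) (fscale B a w) = fscale B a (\<mu> v w)))"

definition vertical_symmetry ::
  "('f \<Rightarrow> 'f \<Rightarrow> 'f) \<Rightarrow> ('f \<Rightarrow> 'm) \<Rightarrow> ('k::dense_unit_ring, 'm, 'f) fibre_ops \<Rightarrow> 'f \<Rightarrow> 'f \<Rightarrow> 'f" where
  "vertical_symmetry \<mu> \<pi> B u =
     \<mu> (fscale B half u) \<circ> \<mu> (fzero B (\<pi> u)) \<circ> fscale B (- 1) \<circ> \<mu> (fscale B half u)"

end

theory Submission
  imports Defs
begin

text \<open>Write \<open>0\<^sub>p\<close> for the zero of the fibre over \<open>p\<close> and \<open>\<sigma>(v)\<close> for the symmetry \<open>\<mu> v\<close>. By fibrewise linearity of
\<open>\<mu>\<close>, \<open>\<mu> v w = \<mu> v 0\<^sub>q + \<mu> 0\<^sub>p w\<close> for \<open>v\<close> over \<open>p\<close> and \<open>w\<close> over \<open>q\<close>. In the composite that defines the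
vertical symmetry \<open>\<nu>(u)\<close> at a vector \<open>u\<close> over \<open>p\<close>, the vector \<open>u/2\<close> acts twice and \<open>(-1)\<^sub>F\<close> is applied in
between, so the two terms \<open>\<mu> (u/2) 0\<^sub>q\<close> cancel. What remains is \<open>\<nu>(u) = (-1)\<^sub>F \<circ> \<sigma>(0\<^sub>p)\<close>
(\<open>vertical_symmetry_eq\<close>).

The map \<open>(-1)\<^sub>F\<close> is an involution that commutes with every \<open>\<sigma>(0\<^sub>p)\<close>, and \<open>\<mu>\<close> maps pairs of zero vectors to
zero vectors. Hence (S2) and (S3) for \<open>\<nu>\<close> follow from (S2) and (S3) for \<open>\<mu>\<close> at zero vectors.

Axiom (S1) for \<open>\<nu>\<close> says that the symmetry at \<open>0\<^sub>p\<close> is \<open>-id\<close> on the fibre over \<open>p\<close>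
(\<open>zero_mult_fibre\<close>), and here (S4) for \<open>F\<close> is used: in a local trivialization the symmetry restricts to a
homogeneous map \<open>A\<close> of the typical fibre, so \<open>A\<close> agrees with its derivative at \<open>0\<close>, and that derivative is
\<open>-id\<close> because the tangent map of the symmetry at \<open>0\<^sub>p\<close> is.

For smoothness, \<open>\<nu> u w = \<mu> (0 u) ((-1) w)\<close> presents \<open>\<nu>\<close> as the composite of \<open>\<mu>\<close> with a product of two
scalar multiplications of the bundle, which are smooth because they are so in local trivializations. This
reduces everything to the closure of smooth maps under products and composition, hence to the chain rule
of the calculus over a topological ring. From \<open>(g \<circ> f)\<^sup>[\<^sup>1\<^sup>] (x, v, t) = g\<^sup>[\<^sup>1\<^sup>] (f x, f\<^sup>[\<^sup>1\<^sup>] (x, v, t), t)\<close> one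
sees that the inner map of the composite on the right takes values in the next level of the tower over
the target module. The induction over the order of differentiability therefore has to treat inner maps
from any level of one tower to any level of another (\<open>tower_Ck_compose\<close>).\<close>

section \<open>Topology of the towers\<close>

lemma topspace_tower_top_0 [simp]: "topspace (tower_top 0) = range Base"
  by (auto simp: topspace_pullback_topology)

lemma topspace_tower_top_Suc [simp]:
  "topspace (tower_top (Suc n)) =
     {Step x v t | x v t. x \<in> topspace (tower_top n) \<and> v \<in> topspace (tower_top n)}"
  by (auto simp: topspace_pullback_topology)

declare tower_top.simps [simp del]

lemma continuous_map_tower_0:
  assumes "continuous_map X euclidean (base \<circ> f)" "\<And>x. x \<in> topspace X \<Longrightarrow> f x \<in> range Base"
  shows "continuous_map X (tower_top 0) f"
  unfolding tower_top.simps by (rule continuous_map_pullback') (use assms in auto)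

lemma continuous_map_tower_Suc:
  assumes "continuous_map X (tower_top n) (pt \<circ> f)" "continuous_map X (tower_top n) (dir \<circ> f)"
    "continuous_map X euclidean (par \<circ> f)"
    "\<And>x. x \<in> topspace X \<Longrightarrow> f x \<in> topspace (tower_top (Suc n))"
  shows "continuous_map X (tower_top (Suc n)) f"
  unfolding tower_top.simps
proof (rule continuous_map_pullback')
  show "continuous_map X (prod_topology (tower_top n) (prod_topology (tower_top n) euclidean))
     ((\<lambda>z. (pt z, dir z, par z)) \<circ> f)"
    using assms by (simp add: continuous_map_pairwise o_def)
qed (use assms(4) in auto)

lemma continuous_map_base: "continuous_map (tower_top 0) euclidean base"
  using continuous_map_pullback[of euclidean euclidean id "range Base" base]
  by (simp add: tower_top.simps)

lemma continuous_map_tower_components: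
  shows continuous_map_pt: "continuous_map (tower_top (Suc n)) (tower_top n) pt"
    and continuous_map_dir: "continuous_map (tower_top (Suc n)) (tower_top n) dir"
    and continuous_map_par: "continuous_map (tower_top (Suc n)) euclidean par"
proof -
  let ?P = "prod_topology (tower_top n) (prod_topology (tower_top n) euclidean)"
  let ?f = "\<lambda>z. (pt z, dir z, par z)"
  have *: "continuous_map (tower_top (Suc n)) ?P ?f"
    using continuous_map_pullback[of ?P ?P id _ ?f] by (simp add: tower_top.simps)
  then show "continuous_map (tower_top (Suc n)) (tower_top n) pt"
    "continuous_map (tower_top (Suc n)) (tower_top n) dir"
    "continuous_map (tower_top (Suc n)) euclidean par"
    by (auto simp: continuous_map_pairwise o_def)
qed

lemma tower_add_scale_closed:
  "x \<in> topspace (tower_top n) \<Longrightarrow> v \<in> topspace (tower_top n) \<Longrightarrow>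
    tower_add x (tower_scale s t v) \<in> topspace (tower_top n)"
proof (induction n arbitrary: x v)
  case 0 then show ?case by auto
next
  case (Suc n) then show ?case by fastforce
qed

lemma continuous_map_plus:
  fixes f g :: "'a \<Rightarrow> 'b::topological_monoid_add"
  assumes "continuous_map X euclidean f" "continuous_map X euclidean g"
  shows "continuous_map X euclidean (\<lambda>x. f x + g x)"
proof -
  have "continuous_map X (prod_topology euclidean euclidean) (\<lambda>x. (f x, g x))"
    unfolding continuous_map_pairwise using assms by (simp add: o_def)
  moreover have "continuous_map (prod_topology euclidean euclidean) euclidean (\<lambda>p::'b \<times> 'b. fst p + snd p)"
    by simp (intro continuous_intros)
  ultimately have "continuous_map X euclidean ((\<lambda>p. fst p + snd p) \<circ> (\<lambda>x. (f x, g x)))"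
    by (rule continuous_map_compose)
  then show ?thesis by (simp add: o_def)
qed

lemma continuous_map_tower_translation:
  fixes f :: "'a \<Rightarrow> ('e::topological_ab_group_add, 'k::dense_unit_ring) tower"
  assumes "continuous_map X (tower_top n) f" "a \<in> topspace (tower_top n)"
  shows "continuous_map X (tower_top n) (\<lambda>z. tower_add (f z) a)"
  using assms
proof (induction n arbitrary: f a)
  case 0
  then obtain b where a: "a = Base b" by auto
  have r: "f z \<in> range Base" if "z \<in> topspace X" for z
    using 0(1) that by (auto simp: continuous_map_def Pi_iff)
  show ?case
  proof (rule continuous_map_tower_0)
    have "continuous_map X euclidean (\<lambda>z. (base \<circ> f) z + b)"
      using 0 by (intro continuous_map_plus continuous_map_compose[OF _ continuous_map_base]) auto
    then show "continuous_map X euclidean (base \<circ> (\<lambda>z. tower_add (f z) a))"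
      by (rule continuous_map_eq) (use r a in fastforce)
  qed (use r a in fastforce)
next
  case (Suc n)
  then obtain b c s where a: "a = Step b c s"
    and bc: "b \<in> topspace (tower_top n)" "c \<in> topspace (tower_top n)" by auto
  have r: "\<exists>x v t. f z = Step x v t \<and> x \<in> topspace (tower_top n) \<and> v \<in> topspace (tower_top n)"
    if "z \<in> topspace X" for z
    using Suc.prems(1) that by (auto simp: continuous_map_def Pi_iff)
  note fc = continuous_map_compose[OF Suc.prems(1)]
  show ?case
  proof (rule continuous_map_tower_Suc)
    show "continuous_map X (tower_top n) (pt \<circ> (\<lambda>z. tower_add (f z) a))"
      using Suc.IH[OF fc[OF continuous_map_pt] bc(1)]
      by (rule continuous_map_eq) (use r a in fastforce)
    show "continuous_map X (tower_top n) (dir \<circ> (\<lambda>z. tower_add (f z) a))"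
      using Suc.IH[OF fc[OF continuous_map_dir] bc(2)]
      by (rule continuous_map_eq) (use r a in fastforce)
    have "continuous_map X euclidean (\<lambda>z. (par \<circ> f) z + s)"
      using fc[OF continuous_map_par] by (intro continuous_map_plus) (auto simp: o_def)
    then show "continuous_map X euclidean (par \<circ> (\<lambda>z. tower_add (f z) a))"
      by (rule continuous_map_eq) (use r a in fastforce)
    show "tower_add (f z) a \<in> topspace (tower_top (Suc n))" if zX: "z \<in> topspace X" for z
    proof -
      obtain x v t where z: "f z = Step x v t" "x \<in> topspace (tower_top n)" "v \<in> topspace (tower_top n)"
        using r[OF zX] by blast
      have "continuous_map X (tower_top n) (\<lambda>z. tower_add ((pt \<circ> f) z) b)"
         "continuous_map X (tower_top n) (\<lambda>z. tower_add ((dir \<circ> f) z) c)"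
        using Suc.IH[OF fc[OF continuous_map_pt] bc(1)] Suc.IH[OF fc[OF continuous_map_dir] bc(2)] .
      then have "tower_add x b \<in> topspace (tower_top n)" "tower_add v c \<in> topspace (tower_top n)"
        using zX z by (force simp: continuous_map_def Pi_iff)+
      then show ?thesis using z a by auto
    qed
  qed
qed

text \<open>Every two points \<open>x, y\<close> are joined by the line \<open>x + t (y - x)\<close>, where the difference is written with
the two tower operations that are available.\<close>

lemma tower_subtract:
  assumes "module s" "x \<in> topspace (tower_top n)" "y \<in> topspace (tower_top n)"
  shows "tower_add x (tower_scale s 1 (tower_add y (tower_scale s (- 1) x))) = y"
  using assms(2,3)
proof (induction n arbitrary: x y)
  case 0
  interpret module s by fact
  show ?case using 0 by auto
next
  case (Suc n)
  then show ?case by auto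
qed

section \<open>Maps of class \<open>C\<^sup>k\<close> on towers\<close>

lemma quotient_domain_topspace:
  "D \<subseteq> topspace (tower_top n) \<Longrightarrow> quotient_domain s n D \<subseteq> topspace (tower_top (Suc n))"
  by (auto simp: quotient_domain_def)

text \<open>The case \<open>t = 1\<close> of the difference quotient gives \<open>g y = g x + g' (x, y - x, 1)\<close> for a fixed \<open>x\<close> and all
\<open>y\<close> in the domain, and the right-hand side is continuous in \<open>y\<close>.\<close>

lemma continuous_if_difference_quotient:
  fixes g :: "('e::topological_ab_group_add, 'k::dense_unit_ring) tower \<Rightarrow> 'f::topological_ab_group_add"
  assumes q: "difference_quotient sE sF n D g g'" and D: "D \<subseteq> topspace (tower_top n)"
    and mE: "module sE" and mF: "module sF"
  shows "continuous_map (subtopology (tower_top n) D) euclidean g"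
proof -
  let ?X = "subtopology (tower_top n) D"
  let ?Y = "subtopology (tower_top (Suc n)) (quotient_domain sE n D)"
  have eq: "g y = g x + g' (Step x (tower_add y (tower_scale sE (- 1) x)) 1)"
    and mem: "Step x (tower_add y (tower_scale sE (- 1) x)) 1 \<in> quotient_domain sE n D"
    if "x \<in> D" "y \<in> D" for x y
  proof -
    have "x \<in> topspace (tower_top n)" "y \<in> topspace (tower_top n)" using that D by auto
    note s = tower_subtract[OF mE this]
    show m: "Step x (tower_add y (tower_scale sE (- 1) x)) 1 \<in> quotient_domain sE n D"
      unfolding quotient_domain_def using that D by (auto simp: s intro: tower_add_scale_closed)
    have "g y - g x = sF 1 (g' (Step x (tower_add y (tower_scale sE (- 1) x)) 1))"
      using q m s unfolding difference_quotient_def by metis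
    then show "g y = g x + g' (Step x (tower_add y (tower_scale sE (- 1) x)) 1)"
      using mF by (simp add: module.scale_one algebra_simps)
  qed
  show ?thesis
  proof (cases "D = {}")
    case True
    then show ?thesis by (simp add: continuous_map_def)
  next
    case False
    then obtain x where x: "x \<in> D" by auto
    then have xT: "x \<in> topspace (tower_top n)" using D by auto
    let ?h = "\<lambda>y. Step x (tower_add y (tower_scale sE (- 1) x)) 1"
    have sx: "tower_scale sE (- 1) x \<in> topspace (tower_top n)"
      using xT by (induction n arbitrary: x) auto
    have id: "continuous_map ?X (tower_top n) (\<lambda>y. y)"
      using continuous_map_from_subtopology[OF continuous_map_id] by (simp add: id_def)
    have "continuous_map ?X (tower_top (Suc n)) ?h"
    proof (rule continuous_map_tower_Suc)
      show "continuous_map ?X (tower_top n) (dir \<circ> ?h)"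
        using continuous_map_tower_translation[OF id sx] by (simp add: o_def)
      show "?h y \<in> topspace (tower_top (Suc n))" if "y \<in> topspace ?X" for y
        using mem[OF x] that quotient_domain_topspace[OF D] by auto
    qed (use xT in \<open>auto simp: o_def\<close>)
    then have "continuous_map ?X ?Y ?h"
      using mem[OF x] by (auto simp: continuous_map_in_subtopology)
    then have "continuous_map ?X euclidean (g' \<circ> ?h)"
      using q unfolding difference_quotient_def by (blast intro: continuous_map_compose)
    then have "continuous_map ?X euclidean (\<lambda>y. g x + (g' \<circ> ?h) y)"
      by (intro continuous_map_plus) (auto simp: o_def)
    then show ?thesis
      by (rule continuous_map_eq) (use eq[OF x] in auto)
  qed
qed

text \<open>The definition of \<open>C\<^sup>k\<close> asks for continuity at the last stage only, so that the orders are nested needs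
an argument: the existence of a continuous difference quotient forces continuity.\<close>

lemma tower_Ck_Suc_imp:
  fixes g :: "('e::topological_ab_group_add, 'k::dense_unit_ring) tower \<Rightarrow> 'f::topological_ab_group_add"
  assumes mE: "module sE" and mF: "module sF"
  shows "tower_Ck sE sF (Suc k) n D g \<Longrightarrow> D \<subseteq> topspace (tower_top n) \<Longrightarrow> tower_Ck sE sF k n D g"
proof (induction k arbitrary: n D g)
  case 0
  then show ?case using continuous_if_difference_quotient[OF _ _ mE mF] by auto
next
  case (Suc k)
  from Suc.prems(1) obtain g' where g': "difference_quotient sE sF n D g g'"
    "tower_Ck sE sF (Suc k) (Suc n) (quotient_domain sE n D) g'" by auto
  then show ?case using Suc.IH[OF g'(2) quotient_domain_topspace[OF Suc.prems(2)]] by auto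
qed

lemma tower_Ck_continuous:
  fixes g :: "('e::topological_ab_group_add, 'k::dense_unit_ring) tower \<Rightarrow> 'f::topological_ab_group_add"
  assumes "module sE" "module sF"
  shows "tower_Ck sE sF k n D g \<Longrightarrow> D \<subseteq> topspace (tower_top n) \<Longrightarrow>
    continuous_map (subtopology (tower_top n) D) euclidean g"
  by (induction k) (use tower_Ck_Suc_imp[OF assms] in auto)

lemma quotient_domainD:
  "Step x v t \<in> quotient_domain s n D \<Longrightarrow>
     x \<in> D \<and> v \<in> topspace (tower_top n) \<and> tower_add x (tower_scale s t v) \<in> D"
  by (auto simp: quotient_domain_def)

lemma tower_Ck_cong:
  assumes "D \<subseteq> topspace (tower_top n)" "\<And>z. z \<in> D \<Longrightarrow> g z = h z" "tower_Ck sE sF k n D g"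
  shows "tower_Ck sE sF k n D h"
proof (cases k)
  case 0
  then show ?thesis using assms by (auto intro: continuous_map_eq)
next
  case (Suc j)
  have "difference_quotient sE sF n D h h'" if "difference_quotient sE sF n D g h'" for h'
    using that assms(2) unfolding difference_quotient_def by (metis quotient_domainD)
  then show ?thesis using Suc assms(3) by auto
qed

section \<open>Composition with linear maps\<close>

text \<open>The single equation covers additivity and homogeneity on the level \<open>E\<^sub>n\<close>, in the shape in which they occur
in difference quotients.\<close>

definition tower_linear ::
  "('k::dense_unit_ring \<Rightarrow> 'e \<Rightarrow> 'e::{ab_group_add,topological_space}) \<Rightarrow> nat \<Rightarrow> nat
    \<Rightarrow> (('e, 'k) tower \<Rightarrow> ('e, 'k) tower) \<Rightarrow> bool" where
  "tower_linear s n m L \<longleftrightarrow> continuous_map (tower_top n) (tower_top m) L \<and>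
     (\<forall>x\<in>topspace (tower_top n). \<forall>v\<in>topspace (tower_top n). \<forall>t.
        L (tower_add x (tower_scale s t v)) = tower_add (L x) (tower_scale s t (L v)))"

text \<open>For linear \<open>L\<close> and any \<open>g\<close> this is the inner map of \<open>(g \<circ> L)\<^sup>[\<^sup>1\<^sup>] = g\<^sup>[\<^sup>1\<^sup>] \<circ> (L \<times> L \<times> id)\<close>.\<close>

definition tower_lift :: "(('e, 'k) tower \<Rightarrow> ('e, 'k) tower) \<Rightarrow> ('e, 'k) tower \<Rightarrow> ('e, 'k) tower" where
  "tower_lift L z = Step (L (pt z)) (L (dir z)) (par z)"

lemma tower_linear_lift:
  assumes "tower_linear s n m L"
  shows "tower_linear s (Suc n) (Suc m) (tower_lift L)"
  unfolding tower_linear_def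
proof
  have L: "continuous_map (tower_top n) (tower_top m) L" using assms by (simp add: tower_linear_def)
  then have Lm: "L z \<in> topspace (tower_top m)" if "z \<in> topspace (tower_top n)" for z
    using that by (auto simp: continuous_map_def Pi_iff)
  show "continuous_map (tower_top (Suc n)) (tower_top (Suc m)) (tower_lift L)"
    by (rule continuous_map_tower_Suc)
      (use Lm continuous_map_compose[OF continuous_map_pt L]
         continuous_map_compose[OF continuous_map_dir L] continuous_map_par
       in \<open>auto simp: o_def tower_lift_def\<close>)
qed (use assms in \<open>auto simp: tower_linear_def tower_lift_def\<close>)

lemma tower_linear_pt: "tower_linear s (Suc n) n pt"
  by (auto simp: tower_linear_def continuous_map_pt)

lemma tower_linear_id: "tower_linear s n n id"
  by (auto simp: tower_linear_def)

text \<open>Since the inner map \<open>L \<times> L \<times> id\<close> of the difference quotient of \<open>g \<circ> L\<close> is linear again, linear inner maps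
admit an induction of their own. It comes before the general chain rule, whose proof composes with the
projection \<open>pt\<close>.\<close>

lemma tower_Ck_compose_linear:
  assumes "tower_linear sE n m L" "L ` D \<subseteq> D'" "D \<subseteq> topspace (tower_top n)"
    "tower_Ck sE sF k m D' g"
  shows "tower_Ck sE sF k n D (g \<circ> L)"
  using assms
proof (induction k arbitrary: n m D D' L g)
  case 0
  have "continuous_map (subtopology (tower_top n) D) (subtopology (tower_top m) D') L"
    using 0(1,2) by (auto simp: tower_linear_def continuous_map_in_subtopology
        intro: continuous_map_from_subtopology)
  then show ?case using continuous_map_compose 0(4) unfolding tower_Ck.simps by blast
next
  case (Suc k)
  obtain g' where g': "difference_quotient sE sF m D' g g'"
    "tower_Ck sE sF k (Suc m) (quotient_domain sE m D') g'" using Suc.prems(4) by auto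
  have Lm: "L z \<in> topspace (tower_top m)" if "z \<in> topspace (tower_top n)" for z
    using that Suc.prems(1) by (auto simp: tower_linear_def continuous_map_def Pi_iff)
  have L: "L (tower_add x (tower_scale sE t v)) = tower_add (L x) (tower_scale sE t (L v))"
    if "x \<in> D" "v \<in> topspace (tower_top n)" for x v t
    using Suc.prems(1,3) that by (auto simp: tower_linear_def)
  have img: "tower_lift L ` quotient_domain sE n D \<subseteq> quotient_domain sE m D'"
  proof safe
    fix z assume "z \<in> quotient_domain sE n D"
    then obtain x v t where z: "z = Step x v t" "x \<in> D" "v \<in> topspace (tower_top n)"
      "tower_add x (tower_scale sE t v) \<in> D" by (auto simp: quotient_domain_def)
    then show "tower_lift L z \<in> quotient_domain sE m D'"
      using Suc.prems(2) L[OF z(2,3), of t] Lm[OF z(3)]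
      by (force simp: quotient_domain_def tower_lift_def)
  qed
  note lift = tower_linear_lift[OF Suc.prems(1)]
  have D1: "quotient_domain sE n D \<subseteq> topspace (tower_top (Suc n))"
    by (rule quotient_domain_topspace[OF Suc.prems(3)])
  have "difference_quotient sE sF n D (g \<circ> L) (g' \<circ> tower_lift L)"
    unfolding difference_quotient_def
  proof (intro conjI allI impI)
    have "continuous_map (subtopology (tower_top (Suc n)) (quotient_domain sE n D))
      (subtopology (tower_top (Suc m)) (quotient_domain sE m D')) (tower_lift L)"
      using lift img by (auto simp: tower_linear_def continuous_map_in_subtopology
        intro: continuous_map_from_subtopology)
    then show "continuous_map (subtopology (tower_top (Suc n)) (quotient_domain sE n D)) euclidean
     (g' \<circ> tower_lift L)"
      using g'(1) unfolding difference_quotient_def by (blast intro: continuous_map_compose)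
  next
    fix x v t assume z: "Step x v t \<in> quotient_domain sE n D"
    then have "tower_lift L (Step x v t) \<in> quotient_domain sE m D'" using img by auto
    then show "(g \<circ> L) (tower_add x (tower_scale sE t v)) - (g \<circ> L) x =
       sF t ((g' \<circ> tower_lift L) (Step x v t))"
      using g'(1) quotient_domainD[OF z] L[of x v t]
      by (auto simp: difference_quotient_def tower_lift_def)
  qed
  then show ?case using Suc.IH[OF lift img D1 g'(2)] unfolding tower_Ck.simps by blast
qed

lemma tower_Ck_subset:
  assumes "tower_Ck sE sF k n D g" "D' \<subseteq> D" "D \<subseteq> topspace (tower_top n)"
  shows "tower_Ck sE sF k n D' g"
  using tower_Ck_compose_linear[OF tower_linear_id, of D' D n sE sF k g] assms by auto

text \<open>A continuous linear \<open>l\<close> has the difference quotient \<open>(x, v, t) \<mapsto> l v\<close>, which is continuous and linear on the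
next level.\<close>

lemma tower_Ck_linear_functional:
  assumes "continuous_map (tower_top n) euclidean l"
    and "\<And>x v t. x \<in> topspace (tower_top n) \<Longrightarrow> v \<in> topspace (tower_top n) \<Longrightarrow>
      l (tower_add x (tower_scale sE t v)) - l x = sF t (l v)"
    and "D \<subseteq> topspace (tower_top n)"
  shows "tower_Ck sE sF k n D l"
  using assms
proof (induction k arbitrary: n D l)
  case 0
  then show ?case by (auto intro: continuous_map_from_subtopology)
next
  case (Suc k)
  have c: "continuous_map (tower_top (Suc n)) euclidean (l \<circ> dir)"
    by (rule continuous_map_compose[OF continuous_map_dir Suc.prems(1)])
  have "tower_Ck sE sF k (Suc n) (quotient_domain sE n D) (l \<circ> dir)"
    by (rule Suc.IH[OF c]) (use Suc.prems quotient_domain_topspace[OF Suc.prems(3), of sE] in auto)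
  moreover have "difference_quotient sE sF n D l (l \<circ> dir)"
    using c Suc.prems(2,3) unfolding difference_quotient_def
    by (auto intro: continuous_map_from_subtopology dest!: quotient_domainD)
  ultimately show ?case by auto
qed

lemma tower_Ck_const:
  assumes "module sF"
  shows "tower_Ck sE sF k n D (\<lambda>_. c)"
proof (induction k arbitrary: n D c)
  case (Suc k)
  have "difference_quotient sE sF n D (\<lambda>_. c) (\<lambda>_. 0)"
    using assms by (auto simp: difference_quotient_def module.scale_zero_right)
  then show ?case using Suc by auto
qed auto

lemma tower_Ck_Pair:
  assumes "tower_Ck sE sF k n D f" "tower_Ck sE sG k n D g"
  shows "tower_Ck sE (\<lambda>a. map_prod (sF a) (sG a)) k n D (\<lambda>z. (f z, g z))"
  using assms
proof (induction k arbitrary: n D f g)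
  case 0
  then show ?case
    using continuous_map_pairwise[of _ euclidean euclidean "\<lambda>z. (f z, g z)"] by (auto simp: o_def)
next
  case (Suc k)
  obtain f' where f': "difference_quotient sE sF n D f f'"
    "tower_Ck sE sF k (Suc n) (quotient_domain sE n D) f'" using Suc.prems(1) by auto
  obtain g' where g': "difference_quotient sE sG n D g g'"
    "tower_Ck sE sG k (Suc n) (quotient_domain sE n D) g'" using Suc.prems(2) by auto
  have "difference_quotient sE (\<lambda>a. map_prod (sF a) (sG a)) n D
     (\<lambda>z. (f z, g z)) (\<lambda>z. (f' z, g' z))"
    using f'(1) g'(1) continuous_map_pairwise[of _ euclidean euclidean "\<lambda>z. (f' z, g' z)"]
    by (auto simp: difference_quotient_def o_def)
  then show ?case using Suc.IH[OF f'(2) g'(2)] by auto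
qed

section \<open>The chain rule\<close>

text \<open>A tower-valued map is \<open>C\<^sup>k\<close> if all its components are, that is, the leaves in the module and the scalar
parameters at the inner nodes. The scalar components are maps into the ring as a module over itself.\<close>

primrec tower_map_Ck ::
  "('k::dense_unit_ring \<Rightarrow> 'e \<Rightarrow> 'e::{ab_group_add,topological_space})
    \<Rightarrow> ('k \<Rightarrow> 'f \<Rightarrow> 'f::{ab_group_add,topological_space})
    \<Rightarrow> nat \<Rightarrow> nat \<Rightarrow> ('e, 'k) tower set \<Rightarrow> nat \<Rightarrow> (('e, 'k) tower \<Rightarrow> ('f, 'k) tower) \<Rightarrow> bool" where
  "tower_map_Ck sE sF k n D 0 T \<longleftrightarrow> T ` D \<subseteq> range Base \<and> tower_Ck sE sF k n D (base \<circ> T)"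
| "tower_map_Ck sE sF k n D (Suc m) T \<longleftrightarrow> T ` D \<subseteq> topspace (tower_top (Suc m)) \<and>
     tower_map_Ck sE sF k n D m (pt \<circ> T) \<and> tower_map_Ck sE sF k n D m (dir \<circ> T) \<and>
     tower_Ck sE (*) k n D (par \<circ> T)"

lemma module_times: "module ((*) :: 'k::comm_ring_1 \<Rightarrow> _)"
  by unfold_locales (auto simp: algebra_simps)

lemma tower_map_Ck_image: "tower_map_Ck sE sF k n D m T \<Longrightarrow> T ` D \<subseteq> topspace (tower_top m)"
  by (cases m) auto

lemma tower_map_Ck_continuous:
  assumes "tower_map_Ck sE sF 0 n D m T"
  shows "continuous_map (subtopology (tower_top n) D) (tower_top m) T"
  using assms
proof (induction m arbitrary: T)
  case 0
  then show ?case by (intro continuous_map_tower_0) auto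
next
  case (Suc m)
  then show ?case by (intro continuous_map_tower_Suc) auto
qed

lemma tower_map_Ck_compose_linear:
  assumes "tower_linear sE n n' L" "L ` D \<subseteq> D'" "D \<subseteq> topspace (tower_top n)"
    "tower_map_Ck sE sF k n' D' m T"
  shows "tower_map_Ck sE sF k n D m (T \<circ> L)"
  using assms(4)
proof (induction m arbitrary: T)
  case 0
  then show ?case using assms(2) tower_Ck_compose_linear[OF assms(1-3), of sF k "base \<circ> T"]
    by (auto simp: o_def)
next
  case (Suc m)
  then show ?case
    using assms(2) tower_Ck_compose_linear[OF assms(1-3), of "(*)" k "par \<circ> T"]
      Suc.IH[of "pt \<circ> T"] Suc.IH[of "dir \<circ> T"]
    by (auto simp: o_def simp del: topspace_tower_top_Suc)
qed

lemma tower_map_Ck_Suc_imp: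
  fixes T :: "('e::topological_ab_group_add, 'k::dense_unit_ring) tower \<Rightarrow> ('f::topological_ab_group_add, 'k) tower"
  assumes "module sE" "module sF" "D \<subseteq> topspace (tower_top n)"
  shows "tower_map_Ck sE sF (Suc k) n D m T \<Longrightarrow> tower_map_Ck sE sF k n D m T"
  using tower_Ck_Suc_imp[OF assms(1,2) _ assms(3), of k]
     tower_Ck_Suc_imp[OF assms(1) module_times _ assms(3), of k]
  by (induction m arbitrary: T) (auto simp del: tower_Ck.simps)

text \<open>The difference quotients of the components are assembled into a tower-valued difference quotient of the
whole map.\<close>

lemma tower_map_Ck_quotient:
  fixes T :: "('e::topological_ab_group_add, 'k::dense_unit_ring) tower \<Rightarrow> ('f::topological_ab_group_add, 'k) tower"
  assumes "tower_map_Ck sE sF (Suc k) n D m T"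
  shows "\<exists>T'. tower_map_Ck sE sF k (Suc n) (quotient_domain sE n D) m T' \<and>
    (\<forall>x v t. Step x v t \<in> quotient_domain sE n D \<longrightarrow>
      T (tower_add x (tower_scale sE t v)) = tower_add (T x) (tower_scale sF t (T' (Step x v t))))"
  using assms
proof (induction m arbitrary: T)
  case 0
  then obtain g' where g': "difference_quotient sE sF n D (base \<circ> T) g'"
    "tower_Ck sE sF k (Suc n) (quotient_domain sE n D) g'" by auto
  have "T (tower_add x (tower_scale sE t v)) = tower_add (T x) (tower_scale sF t (Base (g' (Step x v t))))"
    if z: "Step x v t \<in> quotient_domain sE n D" for x v t
  proof -
    have "T x \<in> range Base" "T (tower_add x (tower_scale sE t v)) \<in> range Base"
      using 0 quotient_domainD[OF z] by (auto simp del: tower_Ck.simps)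
    then obtain a b where "T x = Base a" "T (tower_add x (tower_scale sE t v)) = Base b" by auto
    moreover have "base (T (tower_add x (tower_scale sE t v))) - base (T x) = sF t (g' (Step x v t))"
      using g'(1) z by (auto simp: difference_quotient_def)
    ultimately show ?thesis by (simp add: algebra_simps)
  qed
  then show ?case using g'(2) by (intro exI[of _ "\<lambda>z. Base (g' z)"]) (auto simp: o_def)
next
  case (Suc m)
  obtain P where P: "tower_map_Ck sE sF k (Suc n) (quotient_domain sE n D) m P"
    "\<And>x v t. Step x v t \<in> quotient_domain sE n D \<Longrightarrow>
      pt (T (tower_add x (tower_scale sE t v))) = tower_add (pt (T x)) (tower_scale sF t (P (Step x v t)))"
    using Suc.IH[of "pt \<circ> T"] Suc.prems unfolding tower_map_Ck.simps comp_apply by blast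
  obtain Q where Q: "tower_map_Ck sE sF k (Suc n) (quotient_domain sE n D) m Q"
    "\<And>x v t. Step x v t \<in> quotient_domain sE n D \<Longrightarrow>
      dir (T (tower_add x (tower_scale sE t v))) = tower_add (dir (T x)) (tower_scale sF t (Q (Step x v t)))"
    using Suc.IH[of "dir \<circ> T"] Suc.prems unfolding tower_map_Ck.simps comp_apply by blast
  obtain r where r: "difference_quotient sE (*) n D (par \<circ> T) r"
    "tower_Ck sE (*) k (Suc n) (quotient_domain sE n D) r" using Suc.prems by auto
  let ?T = "\<lambda>z. Step (P z) (Q z) (r z)"
  have "T (tower_add x (tower_scale sE t v)) = tower_add (T x) (tower_scale sF t (?T (Step x v t)))"
    if z: "Step x v t \<in> quotient_domain sE n D" for x v t
  proof -
    have "T x \<in> topspace (tower_top (Suc m))"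
      "T (tower_add x (tower_scale sE t v)) \<in> topspace (tower_top (Suc m))"
      using Suc.prems quotient_domainD[OF z] by (auto simp del: tower_Ck.simps topspace_tower_top_Suc)
    then obtain a b c a' b' c' where "T x = Step a b c" "T (tower_add x (tower_scale sE t v)) = Step a' b' c'"
      by (auto simp: topspace_tower_top_Suc)
    moreover have "par (T (tower_add x (tower_scale sE t v))) - par (T x) = t * r (Step x v t)"
      using r(1) z by (auto simp: difference_quotient_def)
    ultimately show ?thesis using P(2)[OF z] Q(2)[OF z] by (simp add: algebra_simps)
  qed
  moreover have "tower_map_Ck sE sF k (Suc n) (quotient_domain sE n D) (Suc m) ?T"
    using P(1) Q(1) r(2) tower_map_Ck_image[OF P(1)] tower_map_Ck_image[OF Q(1)]
    by (auto simp: o_def image_subset_iff)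
  ultimately show ?case by blast
qed

text \<open>The difference quotient of \<open>h \<circ> T\<close> is \<open>h' \<circ> S\<close> with \<open>S (x, v, t) = (T x, T' (x, v, t), t)\<close>. Here \<open>S\<close> is \<open>C\<^sup>k\<close>
with values one level higher if \<open>T\<close> is \<open>C\<^sup>k\<^sup>+\<^sup>1\<close>: its components are \<open>T \<circ> pt\<close>, the difference quotient of
\<open>T\<close>, and the linear functional \<open>par\<close>. So the induction hypothesis applies to \<open>h' \<circ> S\<close>.\<close>

lemma tower_Ck_compose:
  fixes T :: "('e::topological_ab_group_add, 'k::dense_unit_ring) tower \<Rightarrow> ('f::topological_ab_group_add, 'k) tower"
    and h :: "('f, 'k) tower \<Rightarrow> 'g::topological_ab_group_add"
  assumes mE: "module sE" and mF: "module sF" and mG: "module sG"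
  shows "tower_map_Ck sE sF k n D m T \<Longrightarrow> tower_Ck sF sG k m D' h \<Longrightarrow> T ` D \<subseteq> D' \<Longrightarrow>
    D \<subseteq> topspace (tower_top n) \<Longrightarrow> D' \<subseteq> topspace (tower_top m) \<Longrightarrow> tower_Ck sE sG k n D (h \<circ> T)"
proof (induction k arbitrary: n m D D' T h)
  case 0
  have "continuous_map (subtopology (tower_top n) D) (subtopology (tower_top m) D') T"
    using tower_map_Ck_continuous[OF 0(1)] 0(3) by (auto simp: continuous_map_in_subtopology)
  then show ?case using continuous_map_compose 0(2) unfolding tower_Ck.simps by blast
next
  case (Suc k)
  let ?D1 = "quotient_domain sE n D" and ?D1' = "quotient_domain sF m D'"
  obtain h' where h': "difference_quotient sF sG m D' h h'" "tower_Ck sF sG k (Suc m) ?D1' h'"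
    using Suc.prems(2) by auto
  obtain T' where T': "tower_map_Ck sE sF k (Suc n) ?D1 m T'"
    and T'_eq: "\<And>x v t. Step x v t \<in> ?D1 \<Longrightarrow>
      T (tower_add x (tower_scale sE t v)) = tower_add (T x) (tower_scale sF t (T' (Step x v t)))"
    using tower_map_Ck_quotient[OF Suc.prems(1)] by blast
  define S where "S z = Step (T (pt z)) (T' z) (par z)" for z
  have D1: "?D1 \<subseteq> topspace (tower_top (Suc n))" by (rule quotient_domain_topspace[OF Suc.prems(4)])
  have D1': "?D1' \<subseteq> topspace (tower_top (Suc m))" by (rule quotient_domain_topspace[OF Suc.prems(5)])
  have img: "S ` ?D1 \<subseteq> ?D1'"
  proof safe
    fix z assume "z \<in> ?D1"
    moreover then obtain x v t where z: "z = Step x v t" by (auto simp: quotient_domain_def)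
    ultimately have zD: "Step x v t \<in> ?D1" by simp
    have "T' z \<in> topspace (tower_top m)" using tower_map_Ck_image[OF T'] zD z by blast
    then show "S z \<in> ?D1'"
      using quotient_domainD[OF zD] T'_eq[OF zD] Suc.prems(3) z
      by (force simp: quotient_domain_def S_def)
  qed
  have "tower_map_Ck sE sF k (Suc n) ?D1 m (T \<circ> pt)"
    by (rule tower_map_Ck_compose_linear[OF tower_linear_pt _ D1
          tower_map_Ck_Suc_imp[OF mE mF Suc.prems(4,1)]]) (auto simp: quotient_domain_def)
  moreover have "tower_Ck sE (*) k (Suc n) ?D1 par"
    by (rule tower_Ck_linear_functional[OF continuous_map_par _ D1]) auto
  ultimately have S: "tower_map_Ck sE sF k (Suc n) ?D1 (Suc m) S"
    using T' img D1' by (auto simp: S_def o_def simp del: topspace_tower_top_Suc)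
  have Ck: "tower_Ck sE sG k (Suc n) ?D1 (h' \<circ> S)"
    by (rule Suc.IH[OF S h'(2) img D1 D1'])
  have "difference_quotient sE sG n D (h \<circ> T) (h' \<circ> S)"
    unfolding difference_quotient_def
  proof (intro conjI allI impI)
    show "continuous_map (subtopology (tower_top (Suc n)) ?D1) euclidean (h' \<circ> S)"
      by (rule tower_Ck_continuous[OF mE mG Ck D1])
    fix x v t assume z: "Step x v t \<in> ?D1"
    then have "Step (T x) (T' (Step x v t)) t \<in> ?D1'" using img by (force simp: S_def)
    then show "(h \<circ> T) (tower_add x (tower_scale sE t v)) - (h \<circ> T) x = sG t ((h' \<circ> S) (Step x v t))"
      using h'(1) T'_eq[OF z] by (auto simp: difference_quotient_def S_def)
  qed
  then show ?case using Ck unfolding tower_Ck.simps by blast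
qed

section \<open>Smooth germs\<close>

instance prod :: (topological_monoid_add, topological_monoid_add) topological_monoid_add
proof
  fix a b :: "'a \<times> 'b"
  let ?F = "nhds a \<times>\<^sub>F nhds b"
  have "((\<lambda>p. (fst (fst p) + fst (snd p), snd (fst p) + snd (snd p))) \<longlongrightarrow>
     (fst a + fst b, snd a + snd b)) ?F"
    by (intro tendsto_Pair tendsto_add tendsto_fst tendsto_snd filterlim_fst filterlim_snd)
  then show "((\<lambda>p. fst p + snd p) \<longlongrightarrow> a + b) ?F" by (simp add: plus_prod_def)
qed

instance prod :: (topological_comm_monoid_add, topological_comm_monoid_add) topological_comm_monoid_add ..

instance prod :: (topological_group_add, topological_group_add) topological_group_add
proof
  fix a :: "'a \<times> 'b"
  have "((\<lambda>p. (- fst p, - snd p)) \<longlongrightarrow> (- fst a, - snd a)) (nhds a)"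
    by (intro tendsto_Pair tendsto_minus tendsto_fst tendsto_snd filterlim_ident)
  moreover have "uminus = (\<lambda>p::'a \<times> 'b. (- fst p, - snd p))" by (simp add: fun_eq_iff prod_eq_iff)
  ultimately show "(uminus \<longlongrightarrow> - a) (nhds a)" by (simp add: uminus_prod_def)
qed

instance prod :: (topological_ab_group_add, topological_ab_group_add) topological_ab_group_add ..

lemma continuous_map_tower_top_0_iff:
  "continuous_map (subtopology (tower_top 0) (Base ` W)) euclidean (f \<circ> base) \<longleftrightarrow> continuous_on W f"
proof
  assume a: "continuous_map (subtopology (tower_top 0) (Base ` W)) euclidean (f \<circ> base)"
  have "continuous_map (top_of_set W) (tower_top 0) Base"
    by (rule continuous_map_tower_0) (auto simp: o_def)
  then have "continuous_map (top_of_set W) (subtopology (tower_top 0) (Base ` W)) Base"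
    by (auto simp: continuous_map_in_subtopology)
  from continuous_map_compose[OF this a] show "continuous_on W f" by (simp add: o_def)
next
  assume a: "continuous_on W f"
  have "continuous_map (subtopology (tower_top 0) (Base ` W)) (top_of_set W) base"
    using continuous_map_from_subtopology[OF continuous_map_base]
    by (auto simp: continuous_map_in_subtopology)
  from continuous_map_compose[OF this, of euclidean f] a
  show "continuous_map (subtopology (tower_top 0) (Base ` W)) euclidean (f \<circ> base)" by auto
qed

lemma Ck_on_subset: "Ck_on sE sF k W f \<Longrightarrow> W' \<subseteq> W \<Longrightarrow> Ck_on sE sF k W' f"
  unfolding Ck_on_def by (erule tower_Ck_subset) auto

lemma Ck_on_cong: "Ck_on sE sF k W f \<Longrightarrow> (\<And>x. x \<in> W \<Longrightarrow> f x = g x) \<Longrightarrow> Ck_on sE sF k W g"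
  unfolding Ck_on_def by (erule tower_Ck_cong[rotated 2]) auto

lemma Ck_on_compose:
  fixes sE :: "'k::dense_unit_ring \<Rightarrow> 'e \<Rightarrow> 'e::topological_ab_group_add"
    and sF :: "'k \<Rightarrow> 'f \<Rightarrow> 'f::topological_ab_group_add"
    and sG :: "'k \<Rightarrow> 'g \<Rightarrow> 'g::topological_ab_group_add"
  assumes m: "module sE" "module sF" "module sG"
    and f: "Ck_on sE sF k W f" and g: "Ck_on sF sG k W' g" and img: "f ` W \<subseteq> W'"
  shows "Ck_on sE sG k W (g \<circ> f)"
proof -
  have "tower_map_Ck sE sF k 0 (Base ` W) 0 (Base \<circ> f \<circ> base)"
    using f by (auto simp: Ck_on_def o_def)
  from tower_Ck_compose[OF m this g[unfolded Ck_on_def]]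
  have "tower_Ck sE sG k 0 (Base ` W) ((g \<circ> base) \<circ> ((Base :: 'f \<Rightarrow> ('f, 'k) tower) \<circ> f \<circ> base))"
    using img by (simp add: image_subset_iff)
  then show ?thesis by (simp add: Ck_on_def o_def)
qed

lemma Ck_on_linear:
  assumes "continuous_on UNIV l" "\<And>x y. l (x + y) = l x + l y" "\<And>t x. l (sE t x) = sF t (l x)"
  shows "Ck_on sE sF k W l"
  unfolding Ck_on_def
proof (rule tower_Ck_linear_functional)
  show "continuous_map (tower_top 0) euclidean (l \<circ> base)"
    by (rule continuous_map_compose[OF continuous_map_base]) (use assms in auto)
qed (use assms in \<open>auto simp: algebra_simps\<close>)

lemma Ck_on_const: "module sF \<Longrightarrow> Ck_on sE sF k W (\<lambda>_. c)"
  unfolding Ck_on_def by (simp add: o_def tower_Ck_const)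

lemma Ck_on_Pair:
  "Ck_on sE sF k W f \<Longrightarrow> Ck_on sE sG k W g \<Longrightarrow>
     Ck_on sE (\<lambda>a. map_prod (sF a) (sG a)) k W (\<lambda>x. (f x, g x))"
  unfolding Ck_on_def by (drule (1) tower_Ck_Pair) (simp add: o_def)

text \<open>Pointwise smoothness depends on the germ of the map only, which spares all bookkeeping of domains when
maps between manifolds are read in charts.\<close>

definition smooth_at ::
  "('k::dense_unit_ring \<Rightarrow> 'e \<Rightarrow> 'e::{ab_group_add,topological_space})
    \<Rightarrow> ('k \<Rightarrow> 'f \<Rightarrow> 'f::{ab_group_add,topological_space})
    \<Rightarrow> ('e \<Rightarrow> 'f) \<Rightarrow> 'e \<Rightarrow> bool" where
  "smooth_at sE sF f x \<longleftrightarrow> (\<exists>W. open W \<and> x \<in> W \<and> (\<forall>k. Ck_on sE sF k W f))"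

lemma smooth_on_iff: "smooth_on sE sF U f \<longleftrightarrow> open U \<and> (\<forall>x\<in>U. smooth_at sE sF f x)"
proof
  assume s: "smooth_on sE sF U f"
  then have "open U" unfolding smooth_on_def by (subst open_subopen) blast
  with s show "open U \<and> (\<forall>x\<in>U. smooth_at sE sF f x)" unfolding smooth_on_def smooth_at_def by blast
next
  assume r: "open U \<and> (\<forall>x\<in>U. smooth_at sE sF f x)"
  show "smooth_on sE sF U f"
    unfolding smooth_on_def
  proof
    fix x assume "x \<in> U"
    then obtain W where "open W" "x \<in> W" "\<forall>k. Ck_on sE sF k W f"
      using r unfolding smooth_at_def by blast
    then show "\<exists>W. open W \<and> x \<in> W \<and> W \<subseteq> U \<and> (\<forall>k. Ck_on sE sF k W f)"
      using r \<open>x \<in> U\<close> by (intro exI[of _ "W \<inter> U"]) (auto intro: Ck_on_subset)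
  qed
qed

lemma smooth_at_cong:
  assumes "smooth_at sE sF f x" "open W" "x \<in> W" "\<And>y. y \<in> W \<Longrightarrow> f y = g y"
  shows "smooth_at sE sF g x"
proof -
  obtain V where "open V" "x \<in> V" "\<forall>k. Ck_on sE sF k V f"
    using assms(1) unfolding smooth_at_def by blast
  moreover have "Ck_on sE sF k (V \<inter> W) g" if "Ck_on sE sF k V f" for k
    by (rule Ck_on_cong[OF Ck_on_subset[OF that]]) (use assms in auto)
  ultimately show ?thesis unfolding smooth_at_def using assms by (intro exI[of _ "V \<inter> W"]) auto
qed

text \<open>A neighbourhood on which the inner map is \<open>C\<^sup>k\<close> is shrunk to the preimage of one on which the outer map
is \<open>C\<^sup>k\<close>; the shrunken set serves all \<open>k\<close> at once.\<close>

lemma smooth_at_compose: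
  fixes sE :: "'k::dense_unit_ring \<Rightarrow> 'e \<Rightarrow> 'e::topological_ab_group_add"
    and sF :: "'k \<Rightarrow> 'f \<Rightarrow> 'f::topological_ab_group_add"
    and sG :: "'k \<Rightarrow> 'g \<Rightarrow> 'g::topological_ab_group_add"
  assumes m: "module sE" "module sF" "module sG"
    and f: "smooth_at sE sF f x" and g: "smooth_at sF sG g (f x)"
  shows "smooth_at sE sG (g \<circ> f) x"
proof -
  obtain W where W: "open W" "x \<in> W" "\<forall>k. Ck_on sE sF k W f"
    using f unfolding smooth_at_def by blast
  obtain V where V: "open V" "f x \<in> V" "\<forall>k. Ck_on sF sG k V g"
    using g unfolding smooth_at_def by blast
  have "continuous_on W f"
    using W(3)[rule_format, of 0] by (simp add: Ck_on_def continuous_map_tower_top_0_iff)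
  then have "open (W \<inter> f -` V)" by (rule continuous_open_preimage) (use W V in auto)
  moreover have "Ck_on sE sG k (W \<inter> f -` V) (g \<circ> f)" for k
    by (rule Ck_on_compose[OF m Ck_on_subset[of sE sF k W] V(3)[rule_format]]) (use W in auto)
  ultimately show ?thesis
    unfolding smooth_at_def using W(2) V(2) by (intro exI[of _ "W \<inter> f -` V"]) auto
qed

lemma smooth_at_linear:
  assumes "continuous_on UNIV l" "\<And>x y. l (x + y) = l x + l y" "\<And>t x. l (sE t x) = sF t (l x)"
  shows "smooth_at sE sF l x"
  unfolding smooth_at_def using Ck_on_linear[where l=l and sE=sE and sF=sF, OF assms] by (intro exI[of _ UNIV]) auto

lemma smooth_at_const: "module sF \<Longrightarrow> smooth_at sE sF (\<lambda>_. c) x"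
  unfolding smooth_at_def by (intro exI[of _ UNIV]) (auto intro: Ck_on_const)

lemma smooth_at_Pair:
  assumes "smooth_at sE sF f x" "smooth_at sE sG g x"
  shows "smooth_at sE (\<lambda>a. map_prod (sF a) (sG a)) (\<lambda>x. (f x, g x)) x"
proof -
  obtain W where W: "open W" "x \<in> W" "\<forall>k. Ck_on sE sF k W f"
    using assms unfolding smooth_at_def by blast
  obtain V where V: "open V" "x \<in> V" "\<forall>k. Ck_on sE sG k V g"
    using assms unfolding smooth_at_def by blast
  have "Ck_on sE (\<lambda>a. map_prod (sF a) (sG a)) k (W \<inter> V) (\<lambda>x. (f x, g x))" for k
    using W V by (intro Ck_on_Pair) (auto intro: Ck_on_subset)
  then show ?thesis
    unfolding smooth_at_def using W V by (intro exI[of _ "W \<inter> V"]) auto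
qed

lemma smooth_at_fst: "smooth_at (\<lambda>a. map_prod (sE a) (sF a)) sE fst x"
  and smooth_at_snd: "smooth_at (\<lambda>a. map_prod (sE a) (sF a)) sF snd x"
  by (rule smooth_at_linear; auto intro!: continuous_intros)+

lemma smooth_at_id: "smooth_at sE sE id x"
  by (rule smooth_at_linear) auto

lemma module_map_prod:
  assumes "module s" "module s'"
  shows "module (\<lambda>a. map_prod (s a) (s' a))"
proof -
  interpret a: module s by fact
  interpret b: module s' by fact
  show ?thesis
    by unfold_locales (auto simp: a.scale_right_distrib a.scale_left_distrib
        b.scale_right_distrib b.scale_left_distrib)
qed

lemma smooth_at_map_prod:
  fixes sE :: "'k::dense_unit_ring \<Rightarrow> 'e \<Rightarrow> 'e::topological_ab_group_add"
    and sE' :: "'k \<Rightarrow> 'f \<Rightarrow> 'f::topological_ab_group_add"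
    and sF :: "'k \<Rightarrow> 'g \<Rightarrow> 'g::topological_ab_group_add"
    and sF' :: "'k \<Rightarrow> 'h \<Rightarrow> 'h::topological_ab_group_add"
  assumes m: "module sE" "module sE'" "module sF" "module sF'"
    and f: "smooth_at sE sF f x" and g: "smooth_at sE' sF' g y"
  shows "smooth_at (\<lambda>a. map_prod (sE a) (sE' a)) (\<lambda>a. map_prod (sF a) (sF' a)) (map_prod f g) (x, y)"
proof -
  note mp = module_map_prod[OF m(1,2)]
  have "smooth_at (\<lambda>a. map_prod (sE a) (sE' a)) (\<lambda>a. map_prod (sF a) (sF' a))
     (\<lambda>z. ((f \<circ> fst) z, (g \<circ> snd) z)) (x, y)"
    by (intro smooth_at_Pair smooth_at_compose[OF mp m(1,3) smooth_at_fst]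
        smooth_at_compose[OF mp m(2,4) smooth_at_snd]) (use f g in auto)
  then show ?thesis by (simp add: map_prod_def case_prod_unfold)
qed

section \<open>Directional derivatives\<close>

text \<open>The defining description of \<open>differential\<close> turned into a relation, so that existence, uniqueness and the
chain rule can be treated separately.\<close>

definition has_directional_derivative ::
  "('k::dense_unit_ring \<Rightarrow> 'e \<Rightarrow> 'e::{ab_group_add,topological_space})
    \<Rightarrow> ('k \<Rightarrow> 'f \<Rightarrow> 'f::{ab_group_add,topological_space})
    \<Rightarrow> ('e \<Rightarrow> 'f) \<Rightarrow> 'e \<Rightarrow> 'e \<Rightarrow> 'f \<Rightarrow> bool" where
  "has_directional_derivative sE sF f x v w \<longleftrightarrow>
     (\<exists>W q. open W \<and> x \<in> W \<and> difference_quotient sE sF 0 (Base ` W) (f \<circ> base) q \<and>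
        w = q (Step (Base x) (Base v) 0))"

lemma open_line_preimage:
  assumes "topological_module s" "open W"
  shows "open {t. x + s t v \<in> W}"
proof -
  have "continuous_on UNIV (\<lambda>(a, x). s a x)" using assms(1) by (simp add: topological_module_def)
  then have "continuous_on UNIV ((\<lambda>(a, x). s a x) \<circ> (\<lambda>t. (t, v)))"
    by (intro continuous_on_compose[OF _ continuous_on_subset[of UNIV]] continuous_on_Pair
        continuous_on_id continuous_on_const) auto
  then have "continuous_on UNIV (\<lambda>t. x + s t v)"
    by (intro continuous_intros) (simp add: o_def)
  from open_vimage[OF assms(2) this] show ?thesis by (simp add: vimage_def)
qed

lemma Step_in_quotient_domain_0:
  "Step (Base x) (Base v) t \<in> quotient_domain s 0 (Base ` W) \<longleftrightarrow> x \<in> W \<and> x + s t v \<in> W"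
  by (auto simp: quotient_domain_def)

lemma difference_quotient_0D:
  assumes "difference_quotient sE sF 0 (Base ` W) (f \<circ> base) q" "x \<in> W" "x + sE t v \<in> W"
  shows "f (x + sE t v) - f x = sF t (q (Step (Base x) (Base v) t))"
  using assms by (force simp: difference_quotient_def quotient_domain_def)

lemma continuous_on_difference_quotient_line:
  assumes q: "difference_quotient sE sF 0 (Base ` W) (f \<circ> base) q" and x: "x \<in> W"
  shows "continuous_on {t. x + sE t v \<in> W} (\<lambda>t. q (Step (Base x) (Base v) t))"
proof -
  let ?N = "{t. x + sE t v \<in> W}"
  let ?h = "\<lambda>t. Step (Base x) (Base v) t"
  have "continuous_map (top_of_set ?N) (tower_top (Suc 0)) ?h"
  proof (rule continuous_map_tower_Suc)
    show "continuous_map (top_of_set ?N) euclidean (par \<circ> ?h)"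
      by (simp add: o_def)
  qed (auto simp: o_def)
  then have "continuous_map (top_of_set ?N)
     (subtopology (tower_top (Suc 0)) (quotient_domain sE 0 (Base ` W))) ?h"
    using x by (auto simp: continuous_map_in_subtopology Step_in_quotient_domain_0)
  from continuous_map_compose[OF this, of euclidean q] show ?thesis
    using q by (auto simp: difference_quotient_def o_def)
qed

text \<open>At units \<open>t\<close> the equation determines the difference quotient, so \<open>r\<close> and the quotient along the line
agree there. Units are dense and the target is Hausdorff, so two continuous functions that agree at all
units near \<open>0\<close> agree at \<open>0\<close>.\<close>

lemma directional_derivative_eqI:
  fixes sF :: "'k::dense_unit_ring \<Rightarrow> 'f \<Rightarrow> 'f::{topological_ab_group_add,t2_space}"
  assumes mE: "topological_module sE" and mF: "module sF"
    and d: "has_directional_derivative sE sF f x v w"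
    and O: "open N" "0 \<in> N" and r: "continuous_on N r"
    and eq: "\<And>t. t \<in> N \<Longrightarrow> f (x + sE t v) - f x = sF t (r t)"
  shows "w = r 0"
proof (rule ccontr)
  assume ne: "w \<noteq> r 0"
  interpret E: module sE using mE by (simp add: topological_module_def)
  interpret F: module sF by fact
  obtain W q where W: "open W" "x \<in> W" and q: "difference_quotient sE sF 0 (Base ` W) (f \<circ> base) q"
    and w: "w = q (Step (Base x) (Base v) 0)"
    using d unfolding has_directional_derivative_def by blast
  obtain A B where AB: "open A" "open B" "w \<in> A" "r 0 \<in> B" "A \<inter> B = {}"
    using hausdorff[OF ne] by blast
  let ?q = "\<lambda>t. q (Step (Base x) (Base v) t)"
  let ?L = "{t. x + sE t v \<in> W}"
  have L: "open ?L" "0 \<in> ?L" using open_line_preimage[OF mE W(1)] W(2) by auto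
  have "open (?L \<inter> ?q -` A)"
    by (rule continuous_open_preimage[OF continuous_on_difference_quotient_line[OF q W(2)] L(1) AB(1)])
  moreover have "open (N \<inter> r -` B)" by (rule continuous_open_preimage[OF r O(1) AB(2)])
  ultimately have "open ((?L \<inter> ?q -` A) \<inter> (N \<inter> r -` B))" by blast
  moreover have "0 \<in> (?L \<inter> ?q -` A) \<inter> (N \<inter> r -` B)" using L(2) O(2) AB w by auto
  ultimately obtain a where a: "a dvd 1" "a \<in> ?L" "?q a \<in> A" "a \<in> N" "r a \<in> B"
    using dense_units[of "(?L \<inter> ?q -` A) \<inter> (N \<inter> r -` B)"] by blast
  have "sF a (?q a) = sF a (r a)"
    using difference_quotient_0D[OF q W(2), of a v] a eq[of a] by auto
  moreover obtain b where "b * a = 1" using a(1) by (metis dvdE mult.commute)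
  ultimately have "?q a = r a" by (metis F.scale_one F.scale_scale)
  then show False using a AB by auto
qed

lemma smooth_at_has_directional_derivative:
  assumes "smooth_at sE sF f x"
  obtains w where "has_directional_derivative sE sF f x v w"
proof -
  obtain W where "open W" "x \<in> W" "Ck_on sE sF (Suc 0) W f"
    using assms unfolding smooth_at_def by blast
  then show ?thesis using that
    unfolding has_directional_derivative_def Ck_on_def tower_Ck.simps by blast
qed

lemma has_directional_derivative_unique:
  fixes sF :: "'k::dense_unit_ring \<Rightarrow> 'f \<Rightarrow> 'f::{topological_ab_group_add,t2_space}"
  assumes mE: "topological_module sE" and mF: "module sF"
    and d: "has_directional_derivative sE sF f x v w" "has_directional_derivative sE sF f x v w'"
  shows "w = w'"
proof -
  interpret E: module sE using mE by (simp add: topological_module_def)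
  obtain W q where W: "open W" "x \<in> W" and q: "difference_quotient sE sF 0 (Base ` W) (f \<circ> base) q"
    and w: "w' = q (Step (Base x) (Base v) 0)"
    using d(2) unfolding has_directional_derivative_def by blast
  show ?thesis unfolding w
    by (rule directional_derivative_eqI[OF mE mF d(1) open_line_preimage[OF mE W(1)] _
        continuous_on_difference_quotient_line[OF q W(2)]])
      (use W(2) difference_quotient_0D[OF q W(2)] in auto)
qed

lemma differential_eq:
  fixes sF :: "'k::dense_unit_ring \<Rightarrow> 'f \<Rightarrow> 'f::{topological_ab_group_add,t2_space}"
  assumes "topological_module sE" "module sF" "has_directional_derivative sE sF f x v w"
  shows "differential sE sF f x v = w"
proof -
  have "differential sE sF f x v = (THE w. has_directional_derivative sE sF f x v w)"
    unfolding differential_def has_directional_derivative_def by (rule refl)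
  also have "\<dots> = w"
    using assms by (blast intro: the_equality has_directional_derivative_unique)
  finally show ?thesis .
qed

lemma has_directional_derivative_differential:
  fixes sF :: "'k::dense_unit_ring \<Rightarrow> 'f \<Rightarrow> 'f::{topological_ab_group_add,t2_space}"
  assumes "topological_module sE" "module sF" "smooth_at sE sF f x"
  shows "has_directional_derivative sE sF f x v (differential sE sF f x v)"
  using smooth_at_has_directional_derivative[OF assms(3)] differential_eq[OF assms(1,2)] by metis

text \<open>Reparametrising the line by \<open>t \<mapsto> -t\<close> gives \<open>f (x - t v) - f x = t (- f\<^sup>[\<^sup>1\<^sup>] (x, v, -t))\<close>, and the factor of
\<open>t\<close> is continuous with value \<open>-w\<close> at \<open>0\<close>.\<close>

lemma has_directional_derivative_uminus:
  fixes sF :: "'k::dense_unit_ring \<Rightarrow> 'f \<Rightarrow> 'f::{topological_ab_group_add,t2_space}"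
  assumes mE: "topological_module sE" and mF: "module sF"
    and d: "has_directional_derivative sE sF f x v w"
  shows "has_directional_derivative sE sF f x (- v) (- w)"
proof -
  interpret E: module sE using mE by (simp add: topological_module_def)
  interpret F: module sF by fact
  obtain W q where W: "open W" "x \<in> W" and q: "difference_quotient sE sF 0 (Base ` W) (f \<circ> base) q"
    and w: "w = q (Step (Base x) (Base v) 0)"
    using d unfolding has_directional_derivative_def by blast
  let ?w = "q (Step (Base x) (Base (- v)) 0)"
  have d': "has_directional_derivative sE sF f x (- v) ?w"
    using W q unfolding has_directional_derivative_def by blast
  let ?N = "{t. x + sE t (- v) \<in> W}"
  let ?r = "\<lambda>t. - q (Step (Base x) (Base v) (- t))"
  have "continuous_on ?N ((\<lambda>t. q (Step (Base x) (Base v) t)) \<circ> uminus)"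
    by (rule continuous_on_compose[OF _ continuous_on_subset[OF
            continuous_on_difference_quotient_line[OF q W(2), of v]]])
      (auto intro!: continuous_intros)
  then have r: "continuous_on ?N ?r" by (intro continuous_on_minus) (simp add: o_def)
  have eq: "f (x + sE t (- v)) - f x = sF t (?r t)" if "t \<in> ?N" for t
    using difference_quotient_0D[OF q W(2), of "- t" v] that by simp
  have "?w = ?r 0"
    by (rule directional_derivative_eqI[OF mE mF d' open_line_preimage[OF mE W(1)] _ r eq])
      (use W in auto)
  then show ?thesis using d' w by simp
qed

lemma has_directional_derivative_cong:
  assumes "has_directional_derivative sE sF f x v w" "open V" "x \<in> V" "\<And>y. y \<in> V \<Longrightarrow> f y = g y"
  shows "has_directional_derivative sE sF g x v w"
proof -
  obtain W q where W: "open W" "x \<in> W" and q: "difference_quotient sE sF 0 (Base ` W) (f \<circ> base) q"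
    and w: "w = q (Step (Base x) (Base v) 0)"
    using assms(1) unfolding has_directional_derivative_def by blast
  have sub: "quotient_domain sE 0 (Base ` (W \<inter> V)) \<subseteq> quotient_domain sE 0 (Base ` W)"
    by (auto simp: quotient_domain_def)
  have "difference_quotient sE sF 0 (Base ` (W \<inter> V)) (g \<circ> base) q"
    unfolding difference_quotient_def
  proof (intro conjI allI impI)
    show "continuous_map (subtopology (tower_top (Suc 0)) (quotient_domain sE 0 (Base ` (W \<inter> V)))) euclidean q"
      using q sub continuous_map_from_subtopology_mono unfolding difference_quotient_def by blast
    fix y u t assume z: "Step y u t \<in> quotient_domain sE 0 (Base ` (W \<inter> V))"
    then have "Step y u t \<in> quotient_domain sE 0 (Base ` W)" using sub by blast
    then have "(f \<circ> base) (tower_add y (tower_scale sE t u)) - (f \<circ> base) y = sF t (q (Step y u t))"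
      using q unfolding difference_quotient_def by blast
    then show "(g \<circ> base) (tower_add y (tower_scale sE t u)) - (g \<circ> base) y = sF t (q (Step y u t))"
      using quotient_domainD[OF z] assms(4) by auto
  qed
  then show ?thesis
    using W assms(2,3) w unfolding has_directional_derivative_def by blast
qed

text \<open>The formula \<open>(g \<circ> f)\<^sup>[\<^sup>1\<^sup>] (x, v, t) = g\<^sup>[\<^sup>1\<^sup>] (f x, f\<^sup>[\<^sup>1\<^sup>] (x, v, t), t)\<close>, evaluated at \<open>t = 0\<close>.\<close>

lemma has_directional_derivative_compose:
  fixes f :: "'e::topological_ab_group_add \<Rightarrow> 'f::topological_ab_group_add"
    and sE :: "'k::dense_unit_ring \<Rightarrow> 'e \<Rightarrow> 'e"
  assumes m: "module sE" "module sF"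
    and f: "has_directional_derivative sE sF f x v w"
    and g: "has_directional_derivative sF sG g (f x) w z"
  shows "has_directional_derivative sE sG (g \<circ> f) x v z"
proof -
  obtain W q where W: "open W" "x \<in> W" and q: "difference_quotient sE sF 0 (Base ` W) (f \<circ> base) q"
    and w: "w = q (Step (Base x) (Base v) 0)"
    using f unfolding has_directional_derivative_def by blast
  obtain V r where V: "open V" "f x \<in> V" and r: "difference_quotient sF sG 0 (Base ` V) (g \<circ> base) r"
    and z: "z = r (Step (Base (f x)) (Base w) 0)"
    using g unfolding has_directional_derivative_def by blast
  have fW: "continuous_on W f"
    using continuous_if_difference_quotient[OF q _ m]
    by (auto simp: continuous_map_tower_top_0_iff)
  let ?N = "W \<inter> f -` V"
  let ?D = "quotient_domain sE 0 (Base ` ?N)"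
  have N: "open ?N" by (rule continuous_open_preimage[OF fW W(1) V(1)])
  define h where "h y = Step (Base (f (base (pt y)))) (Base (q y)) (par y)" for y
  let ?X = "subtopology (tower_top (Suc 0)) ?D"
  have sub: "?D \<subseteq> quotient_domain sE 0 (Base ` W)" by (auto simp: quotient_domain_def)
  have h_mem: "h (Step (Base y) (Base u) t) \<in> quotient_domain sF 0 (Base ` V)"
    and h_eq: "(g \<circ> f) (y + sE t u) - (g \<circ> f) y = sG t (r (h (Step (Base y) (Base u) t)))"
    if "y \<in> ?N" "y + sE t u \<in> ?N" for y u t
  proof -
    have "f (y + sE t u) = f y + sF t (q (Step (Base y) (Base u) t))"
      using difference_quotient_0D[OF q, of y t u] that by (simp add: algebra_simps)
    then show "h (Step (Base y) (Base u) t) \<in> quotient_domain sF 0 (Base ` V)"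
      "(g \<circ> f) (y + sE t u) - (g \<circ> f) y = sG t (r (h (Step (Base y) (Base u) t)))"
      using difference_quotient_0D[OF r, of "f y" t "q (Step (Base y) (Base u) t)"] that
      by (auto simp: h_def Step_in_quotient_domain_0)
  qed
  have D: "\<exists>a u t. y = Step (Base a) (Base u) t \<and> a \<in> ?N \<and> a + sE t u \<in> ?N" if "y \<in> ?D" for y
    using that by (force simp: quotient_domain_def)
  have ptX: "continuous_map ?X (subtopology (tower_top 0) (Base ` W)) pt"
    using continuous_map_from_subtopology[OF continuous_map_pt]
    by (auto simp: continuous_map_in_subtopology quotient_domain_def)
  have "continuous_map ?X (tower_top (Suc 0)) h"
  proof (rule continuous_map_tower_Suc)
    have "continuous_map ?X euclidean ((f \<circ> base) \<circ> pt)"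
      by (rule continuous_map_compose[OF ptX]) (use fW in \<open>simp add: continuous_map_tower_top_0_iff\<close>)
    then show "continuous_map ?X (tower_top 0) (pt \<circ> h)"
      by (intro continuous_map_tower_0) (auto simp: o_def h_def)
    have "continuous_map ?X euclidean q"
      using q sub continuous_map_from_subtopology_mono unfolding difference_quotient_def by blast
    then show "continuous_map ?X (tower_top 0) (dir \<circ> h)"
      by (intro continuous_map_tower_0) (auto simp: o_def h_def)
    show "continuous_map ?X euclidean (par \<circ> h)"
      using continuous_map_from_subtopology[OF continuous_map_par] by (simp add: o_def h_def)
  qed (auto simp: h_def)
  then have "continuous_map ?X (subtopology (tower_top (Suc 0)) (quotient_domain sF 0 (Base ` V))) h"
    using h_mem D by (fastforce simp: continuous_map_in_subtopology)
  then have "continuous_map ?X euclidean (r \<circ> h)"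
    using r unfolding difference_quotient_def by (blast intro: continuous_map_compose)
  moreover have "((g \<circ> f) \<circ> base) (tower_add y (tower_scale sE t u)) - ((g \<circ> f) \<circ> base) y = sG t ((r \<circ> h) (Step y u t))"
    if "Step y u t \<in> ?D" for y u t
    using D[OF that] h_eq by auto
  ultimately have "difference_quotient sE sG 0 (Base ` ?N) ((g \<circ> f) \<circ> base) (r \<circ> h)"
    unfolding difference_quotient_def by blast
  moreover have "z = (r \<circ> h) (Step (Base x) (Base v) 0)" using z w by (simp add: h_def)
  ultimately show ?thesis
    unfolding has_directional_derivative_def using N W(2) V(2) by blast
qed

lemma has_directional_derivative_locally_id:
  fixes sE :: "'k::dense_unit_ring \<Rightarrow> 'e \<Rightarrow> 'e::{topological_ab_group_add,t2_space}"
  assumes s: "topological_module sE" and W: "open W" "x \<in> W" "\<And>y. y \<in> W \<Longrightarrow> f y = y"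
  shows "has_directional_derivative sE sE f x v v"
proof -
  have m: "module sE" using s by (simp add: topological_module_def)
  interpret module sE by fact
  have "smooth_at sE sE f x"
    by (rule smooth_at_cong[OF smooth_at_id W(1,2)]) (simp add: W(3))
  then obtain w where w: "has_directional_derivative sE sE f x v w"
    by (rule smooth_at_has_directional_derivative)
  have "w = v"
    by (rule directional_derivative_eqI[OF s m w open_line_preimage[OF s W(1), of x v], of "\<lambda>_. v"])
      (use W in auto)
  then show ?thesis using w by simp
qed

section \<open>Smooth maps between manifolds\<close>

text \<open>The part of the manifold axioms that concerns the topology alone. It turns smoothness of a continuous map
into a pointwise condition on chart representatives, and open subsets and products inherit it directly
from their constituents.\<close>

definition charted :: "('k, 'm, 'e::topological_space) manifold_data \<Rightarrow> bool" where
  "charted M \<longleftrightarrow> (\<forall>c\<in>atlas M. is_chart (mtop M) c) \<and> (\<Union>c\<in>atlas M. fst c) = mspace M"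

lemma manifold_charted: "manifold M \<Longrightarrow> charted M"
  by (simp add: manifold_def charted_def)

lemma charted_is_chart: "charted M \<Longrightarrow> c \<in> atlas M \<Longrightarrow> is_chart (mtop M) c"
  by (simp add: charted_def)

lemma is_chart_subset: "is_chart X c \<Longrightarrow> fst c \<subseteq> topspace X"
  by (simp add: is_chart_def openin_subset)

lemma is_chart_inj_on:
  assumes "is_chart X c"
  shows "inj_on (snd c) (fst c)"
proof -
  have "inj_on (snd c) (topspace (subtopology X (fst c)))"
    using assms homeomorphic_imp_injective_map unfolding is_chart_def by blast
  then show ?thesis using is_chart_subset[OF assms] by (simp add: inf.absorb2)
qed

lemma is_chart_open_image:
  assumes c: "is_chart X c" and S: "openin X S" "S \<subseteq> fst c"
  shows "open (snd c ` S)"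
proof -
  have "openin (subtopology X (fst c)) S" using S unfolding openin_subtopology by blast
  then have "openin (top_of_set (snd c ` fst c)) (snd c ` S)"
    using homeomorphic_imp_open_map c unfolding is_chart_def open_map_def by blast
  moreover have "open (snd c ` fst c)" using c by (simp add: is_chart_def)
  ultimately show ?thesis by (simp add: openin_open_eq)
qed

lemma chart_inv_chart: "is_chart X c \<Longrightarrow> p \<in> fst c \<Longrightarrow> chart_inv c (snd c p) = p"
  by (simp add: chart_inv_def is_chart_inj_on)

text \<open>Germs at \<open>c(p)\<close> are compared through points \<open>c(y)\<close> with \<open>y\<close> near \<open>p\<close>, where the local inverse of the chart
cancels against the chart.\<close>

lemma smooth_at_cong_chart:
  assumes c: "is_chart X c" and S: "openin X S" "S \<subseteq> fst c" "p \<in> S"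
    and eq: "\<And>y. y \<in> S \<Longrightarrow> f (snd c y) = g (snd c y)"
    and f: "smooth_at sE sF f (snd c p)"
  shows "smooth_at sE sF g (snd c p)"
  using f by (rule smooth_at_cong[OF _ is_chart_open_image[OF c S(1,2)]]) (use S eq in auto)

lemma openin_preimage_chart:
  assumes "continuous_map X Y f" "is_chart X c" "is_chart Y d"
  shows "openin X (fst c \<inter> f -` fst d)"
proof -
  have "fst c \<inter> f -` fst d = fst c \<inter> {p \<in> topspace X. f p \<in> fst d}"
    using is_chart_subset[OF assms(2)] by auto
  moreover have "openin X {p \<in> topspace X. f p \<in> fst d}"
    using openin_continuous_map_preimage[OF assms(1)] assms(3) by (auto simp: is_chart_def)
  ultimately show ?thesis using assms(2) by (auto simp: is_chart_def)
qed

lemma smooth_map_iff: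
  assumes M: "charted M" and N: "charted N"
  shows "smooth_map M N f \<longleftrightarrow> continuous_map (mtop M) (mtop N) f \<and>
    (\<forall>c\<in>atlas M. \<forall>d\<in>atlas N. \<forall>p\<in>fst c. f p \<in> fst d \<longrightarrow>
       smooth_at (mscale M) (mscale N) (snd d \<circ> f \<circ> chart_inv c) (snd c p))"
proof -
  have "open (snd c ` (fst c \<inter> f -` fst d))"
    if "continuous_map (mtop M) (mtop N) f" "c \<in> atlas M" "d \<in> atlas N" for c d
  proof -
    have c: "is_chart (mtop M) c" and d: "is_chart (mtop N) d" using M N that by (auto simp: charted_def)
    show ?thesis by (rule is_chart_open_image[OF c openin_preimage_chart[OF that(1) c d]]) auto
  qed
  then show ?thesis unfolding smooth_map_def smooth_on_iff by blast
qed

lemma smooth_map_continuous: "smooth_map M N f \<Longrightarrow> continuous_map (mtop M) (mtop N) f"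
  by (simp add: smooth_map_def)

lemma smooth_mapD:
  assumes "charted M" "charted N" "smooth_map M N f"
    "c \<in> atlas M" "d \<in> atlas N" "p \<in> fst c" "f p \<in> fst d"
  shows "smooth_at (mscale M) (mscale N) (snd d \<circ> f \<circ> chart_inv c) (snd c p)"
  using assms smooth_map_iff by blast

text \<open>Near a point \<open>p\<close> a chart \<open>e\<close> of the middle space at \<open>f(p)\<close> is inserted:
\<open>d g f c\<^sup>-\<^sup>1 = (d g e\<^sup>-\<^sup>1) (e f c\<^sup>-\<^sup>1)\<close>.\<close>

lemma smooth_map_compose:
  fixes M :: "('k::dense_unit_ring, 'm, 'e::topological_ab_group_add) manifold_data"
    and N :: "('k, 'n, 'f::topological_ab_group_add) manifold_data"
    and P :: "('k, 'p, 'g::topological_ab_group_add) manifold_data"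
  assumes M: "charted M" "module (mscale M)" and N: "charted N" "module (mscale N)"
    and P: "charted P" "module (mscale P)"
    and f: "smooth_map M N f" and g: "smooth_map N P g"
  shows "smooth_map M P (g \<circ> f)"
  unfolding smooth_map_iff[OF M(1) P(1)]
proof (intro conjI ballI impI)
  have fc: "continuous_map (mtop M) (mtop N) f" using f by (rule smooth_map_continuous)
  then show "continuous_map (mtop M) (mtop P) (g \<circ> f)"
    using smooth_map_continuous[OF g] by (rule continuous_map_compose)
  fix c d p assume c: "c \<in> atlas M" and d: "d \<in> atlas P" and p: "p \<in> fst c" and gfp: "(g \<circ> f) p \<in> fst d"
  have cM: "is_chart (mtop M) c" using M c by (auto simp: charted_def)
  have "f p \<in> mspace N" using is_chart_subset[OF cM] p fc by (auto simp: continuous_map_def)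
  then obtain e where e: "e \<in> atlas N" "f p \<in> fst e" using N(1) unfolding charted_def by blast
  have eN: "is_chart (mtop N) e" using N e by (auto simp: charted_def)
  have 1: "smooth_at (mscale M) (mscale N) (snd e \<circ> f \<circ> chart_inv c) (snd c p)"
    by (rule smooth_mapD[OF M(1) N(1) f c e(1) p e(2)])
  have 2: "smooth_at (mscale N) (mscale P) (snd d \<circ> g \<circ> chart_inv e) (snd e (f p))"
    by (rule smooth_mapD[OF N(1) P(1) g e(1) d e(2)]) (use gfp in simp)
  have "smooth_at (mscale M) (mscale P) ((snd d \<circ> g \<circ> chart_inv e) \<circ> (snd e \<circ> f \<circ> chart_inv c)) (snd c p)"
    by (rule smooth_at_compose[OF M(2) N(2) P(2) 1]) (use 2 chart_inv_chart[OF cM p] in simp)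
  then show "smooth_at (mscale M) (mscale P) (snd d \<circ> (g \<circ> f) \<circ> chart_inv c) (snd c p)"
    by (rule smooth_at_cong_chart[OF cM openin_preimage_chart[OF fc cM eN], rotated 3])
      (use p e(2) chart_inv_chart[OF cM] chart_inv_chart[OF eN] in auto)
qed

lemma smooth_map_cong:
  assumes M: "charted M" and N: "charted N" and f: "smooth_map M N f"
    and eq: "\<And>p. p \<in> mspace M \<Longrightarrow> f p = g p"
  shows "smooth_map M N g"
  unfolding smooth_map_iff[OF M N]
proof (intro conjI ballI impI)
  show "continuous_map (mtop M) (mtop N) g"
    using smooth_map_continuous[OF f] eq by (rule continuous_map_eq)
  fix c d p assume c: "c \<in> atlas M" and d: "d \<in> atlas N" and p: "p \<in> fst c" and gp: "g p \<in> fst d"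
  have cM: "is_chart (mtop M) c" using M c by (auto simp: charted_def)
  have eq: "f y = g y" if "y \<in> fst c" for y using eq is_chart_subset[OF cM] that by auto
  have "smooth_at (mscale M) (mscale N) (snd d \<circ> f \<circ> chart_inv c) (snd c p)"
    by (rule smooth_mapD[OF M N f c d p]) (use gp eq p in simp)
  then show "smooth_at (mscale M) (mscale N) (snd d \<circ> g \<circ> chart_inv c) (snd c p)"
    by (rule smooth_at_cong_chart[OF cM, where S = "fst c", rotated 4])
      (use cM p eq chart_inv_chart[OF cM] in \<open>auto simp: is_chart_def\<close>)
qed

section \<open>Open submanifolds and products\<close>

lemma open_submanifold_simps [simp]:
  "mtop (open_submanifold M U) = subtopology (mtop M) U"
  "mscale (open_submanifold M U) = mscale M"
  "atlas (open_submanifold M U) = {(fst c \<inter> U, snd c) | c. c \<in> atlas M}"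
  by (auto simp: open_submanifold_def)

lemma is_chart_open_submanifold:
  assumes c: "is_chart X c" and U: "openin X U"
  shows "is_chart (subtopology X U) (fst c \<inter> U, snd c)"
proof -
  have o: "openin X (fst c \<inter> U)" using c U by (auto simp: is_chart_def)
  have h: "homeomorphic_map (subtopology X (fst c)) (top_of_set (snd c ` fst c)) (snd c)"
    using c by (simp add: is_chart_def)
  have "homeomorphic_map (subtopology (subtopology X (fst c)) U)
     (subtopology (top_of_set (snd c ` fst c)) (snd c ` (fst c \<inter> U))) (snd c)"
    by (rule homeomorphic_map_subtopologies[OF h]) (use is_chart_subset[OF c] in auto)
  moreover have "subtopology (subtopology X (fst c)) U = subtopology (subtopology X U) (fst c \<inter> U)"
    by (simp add: subtopology_subtopology inf_commute inf_left_commute)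
  moreover have "subtopology (top_of_set (snd c ` fst c)) (snd c ` (fst c \<inter> U)) = top_of_set (snd c ` (fst c \<inter> U))"
    by (simp add: subtopology_subtopology inf.absorb2 image_mono)
  moreover have "openin (subtopology X U) (fst c \<inter> U)"
    using o by (simp add: openin_open_subtopology[OF U])
  ultimately show ?thesis
    using is_chart_open_image[OF c o] by (auto simp: is_chart_def)
qed

lemma chart_inv_open_submanifold:
  assumes c: "is_chart X c" and "p \<in> fst c \<inter> U"
  shows "chart_inv (fst c \<inter> U, snd c) (snd c p) = p"
  using inj_on_subset[OF is_chart_inj_on[OF c], of "fst c \<inter> U"] assms(2) by (simp add: chart_inv_def)

lemma charted_open_submanifold:
  assumes "charted M" "openin (mtop M) U"
  shows "charted (open_submanifold M U)"
  unfolding charted_def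
proof
  show "\<forall>c\<in>atlas (open_submanifold M U). is_chart (mtop (open_submanifold M U)) c"
    using assms by (auto simp: charted_def intro!: is_chart_open_submanifold[of _ "(a, b)" for a b, simplified])
  have "(\<Union>c\<in>atlas (open_submanifold M U). fst c) = (\<Union>c\<in>atlas M. fst c) \<inter> U" by force
  then show "(\<Union>c\<in>atlas (open_submanifold M U). fst c) = mspace (open_submanifold M U)"
    using assms(1) by (simp add: charted_def)
qed

text \<open>In charts the identity is a transition map, so its smoothness is the compatibility of the charts.\<close>

lemma smooth_map_id_open_submanifold:
  assumes M: "manifold M" and U: "openin (mtop M) U"
  shows "smooth_map (open_submanifold M U) (open_submanifold M U) id"
  unfolding smooth_map_iff[OF charted_open_submanifold[OF manifold_charted[OF M] U]
      charted_open_submanifold[OF manifold_charted[OF M] U]]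
proof (intro conjI ballI impI)
  fix c' d' p assume "c' \<in> atlas (open_submanifold M U)" "d' \<in> atlas (open_submanifold M U)"
    and p: "p \<in> fst c'" "id p \<in> fst d'"
  then obtain c d where cd: "c \<in> atlas M" "d \<in> atlas M"
    and c': "c' = (fst c \<inter> U, snd c)" and d': "d' = (fst d \<inter> U, snd d)" by auto
  have c: "is_chart (mtop M) c" and d: "is_chart (mtop M) d"
    using M cd by (auto simp: manifold_def)
  have s: "smooth_at (mscale M) (mscale M) (snd d \<circ> chart_inv c) (snd c p)"
    using M cd p c' d' by (auto simp: manifold_def smooth_on_iff)
  show "smooth_at (mscale (open_submanifold M U)) (mscale (open_submanifold M U))
     (snd d' \<circ> id \<circ> chart_inv c') (snd c' p)"
    unfolding c' d' open_submanifold_simps snd_conv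
    by (rule smooth_at_cong_chart[OF c, where S = "fst c \<inter> U", OF _ _ _ _ s])
      (use c U p c' chart_inv_chart[OF c] chart_inv_open_submanifold[OF c] in \<open>auto simp: is_chart_def\<close>)
qed auto

text \<open>Smoothness may be tested on open sets that cover the source, each of them mapped into an open subset of
the target: restricting charts does not change germs of chart representatives.\<close>

lemma smooth_map_local:
  assumes M: "charted M" and N: "charted N"
    and loc: "\<And>p. p \<in> mspace M \<Longrightarrow> \<exists>U V. openin (mtop M) U \<and> p \<in> U \<and> openin (mtop N) V \<and>
       smooth_map (open_submanifold M U) (open_submanifold N V) f"
  shows "smooth_map M N f"
proof -
  obtain U V where UV: "\<And>p. p \<in> mspace M \<Longrightarrow> openin (mtop M) (U p) \<and> p \<in> U p \<and>
      openin (mtop N) (V p) \<and> smooth_map (open_submanifold M (U p)) (open_submanifold N (V p)) f"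
    using loc by metis
  have cont: "continuous_map (subtopology (mtop M) (U p)) (subtopology (mtop N) (V p)) f"
    if "p \<in> mspace M" for p
    using smooth_map_continuous[of "open_submanifold M (U p)" "open_submanifold N (V p)" f] UV[OF that]
    by simp
  show ?thesis
    unfolding smooth_map_iff[OF M N]
  proof (intro conjI ballI impI)
    show "continuous_map (mtop M) (mtop N) f"
    proof (rule pasting_lemma[of "mspace M" "mtop M" U "mtop N" "\<lambda>_. f"])
      show "continuous_map (subtopology (mtop M) (U p)) (mtop N) f" if "p \<in> mspace M" for p
        using cont[OF that] by (simp add: continuous_map_in_subtopology)
    qed (use UV in blast)+
    fix c d p assume cd: "c \<in> atlas M" "d \<in> atlas N" and p: "p \<in> fst c" "f p \<in> fst d"
    have c: "is_chart (mtop M) c" and d: "is_chart (mtop N) d"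
      using M N cd by (auto simp: charted_def)
    have pM: "p \<in> mspace M" using is_chart_subset[OF c] p by auto
    have "f \<in> topspace (subtopology (mtop M) (U p)) \<rightarrow> topspace (subtopology (mtop N) (V p))"
      using cont[OF pM] unfolding continuous_map_def by blast
    then have fpV: "f p \<in> V p" using UV[OF pM] pM by (simp add: Pi_iff)
    have cU: "(fst c \<inter> U p, snd c) \<in> atlas (open_submanifold M (U p))"
      and dV: "(fst d \<inter> V p, snd d) \<in> atlas (open_submanifold N (V p))"
      unfolding open_submanifold_simps using cd by blast+
    have "openin (mtop M) (U p)" "openin (mtop N) (V p)" "p \<in> U p"
      "smooth_map (open_submanifold M (U p)) (open_submanifold N (V p)) f"
      using UV[OF pM] by blast+
    note s = smooth_mapD[OF charted_open_submanifold[OF M this(1)] charted_open_submanifold[OF N this(2)] this(4) cU dV]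
    have "smooth_at (mscale (open_submanifold M (U p))) (mscale (open_submanifold N (V p)))
        (snd (fst d \<inter> V p, snd d) \<circ> f \<circ> chart_inv (fst c \<inter> U p, snd c)) (snd (fst c \<inter> U p, snd c) p)"
      by (rule s) (use p fpV \<open>p \<in> U p\<close> in auto)
    then show "smooth_at (mscale M) (mscale N) (snd d \<circ> f \<circ> chart_inv c) (snd c p)"
      unfolding open_submanifold_simps snd_conv
      by (rule smooth_at_cong_chart[OF c, where S = "fst c \<inter> U p", rotated 4])
        (use c UV[OF pM] p chart_inv_chart[OF c] chart_inv_open_submanifold[OF c] in \<open>auto simp: is_chart_def\<close>)
  qed
qed

lemma prod_manifold_simps [simp]:
  "mtop (prod_manifold M N) = prod_topology (mtop M) (mtop N)"
  "mscale (prod_manifold M N) = (\<lambda>a. map_prod (mscale M a) (mscale N a))"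
  "atlas (prod_manifold M N) =
     {(fst c \<times> fst d, map_prod (snd c) (snd d)) | c d. c \<in> atlas M \<and> d \<in> atlas N}"
  by (auto simp: prod_manifold_def)

lemma module_manifold_simps [simp]:
  "mtop (module_manifold s) = euclidean"
  "mscale (module_manifold s) = s"
  "atlas (module_manifold s) = {(UNIV, id)}"
  by (auto simp: module_manifold_def)

lemma charted_module_manifold: "charted (module_manifold s)"
  by (auto simp: charted_def is_chart_def)

lemma chart_inv_UNIV_id [simp]: "chart_inv (UNIV, id) = id"
  by (auto simp: chart_inv_def)

lemma is_chart_prod:
  assumes c: "is_chart X c" and d: "is_chart Y d"
  shows "is_chart (prod_topology X Y) (fst c \<times> fst d, map_prod (snd c) (snd d))"
proof -
  obtain g where g: "homeomorphic_maps (subtopology X (fst c)) (top_of_set (snd c ` fst c)) (snd c) g"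
    using c by (auto simp: is_chart_def homeomorphic_map_maps)
  obtain h where h: "homeomorphic_maps (subtopology Y (fst d)) (top_of_set (snd d ` fst d)) (snd d) h"
    using d by (auto simp: is_chart_def homeomorphic_map_maps)
  have "homeomorphic_maps (prod_topology (subtopology X (fst c)) (subtopology Y (fst d)))
     (prod_topology (top_of_set (snd c ` fst c)) (top_of_set (snd d ` fst d)))
     (\<lambda>(x, y). (snd c x, snd d y)) (\<lambda>(x, y). (g x, h y))"
    using g h unfolding homeomorphic_maps_prod by blast
  then have "homeomorphic_map (subtopology (prod_topology X Y) (fst c \<times> fst d))
     (top_of_set ((snd c ` fst c) \<times> (snd d ` fst d))) (map_prod (snd c) (snd d))"
    by (auto simp: homeomorphic_map_maps map_prod_def subtopology_Times[symmetric] prod_topology_subtopology_eu)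
  moreover have "map_prod (snd c) (snd d) ` (fst c \<times> fst d) = (snd c ` fst c) \<times> (snd d ` fst d)"
    by (rule map_prod_surj_on) auto
  ultimately show ?thesis
    using c d by (auto simp: is_chart_def openin_prod_Times_iff open_Times)
qed

lemma charted_prod_manifold:
  assumes "charted M" "charted N"
  shows "charted (prod_manifold M N)"
  unfolding charted_def
proof
  show "\<forall>e\<in>atlas (prod_manifold M N). is_chart (mtop (prod_manifold M N)) e"
  proof
    fix e assume "e \<in> atlas (prod_manifold M N)"
    then obtain c d where "c \<in> atlas M" "d \<in> atlas N" "e = (fst c \<times> fst d, map_prod (snd c) (snd d))"
      unfolding prod_manifold_simps by blast
    then show "is_chart (mtop (prod_manifold M N)) e"
      using assms by (simp add: charted_def is_chart_prod)
  qed
  have "(\<Union>c\<in>atlas (prod_manifold M N). fst c) = (\<Union>c\<in>atlas M. fst c) \<times> (\<Union>c\<in>atlas N. fst c)"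
  proof (intro equalityI subsetI)
    fix z assume "z \<in> (\<Union>c\<in>atlas (prod_manifold M N). fst c)"
    then obtain c d where "c \<in> atlas M" "d \<in> atlas N" "z \<in> fst c \<times> fst d" by auto
    then show "z \<in> (\<Union>c\<in>atlas M. fst c) \<times> (\<Union>c\<in>atlas N. fst c)" by blast
  next
    fix z assume "z \<in> (\<Union>c\<in>atlas M. fst c) \<times> (\<Union>c\<in>atlas N. fst c)"
    then obtain c d where cd: "c \<in> atlas M" "d \<in> atlas N" and z: "z \<in> fst c \<times> fst d" by blast
    have "(fst c \<times> fst d, map_prod (snd c) (snd d)) \<in> atlas (prod_manifold M N)"
      using cd unfolding prod_manifold_simps by blast
    then show "z \<in> (\<Union>c\<in>atlas (prod_manifold M N). fst c)"
      by (rule UN_I) (use z in simp)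
  qed
  then show "(\<Union>c\<in>atlas (prod_manifold M N). fst c) = mspace (prod_manifold M N)"
    using assms by (simp add: charted_def)
qed

lemma smooth_map_map_prod:
  fixes M :: "('k::dense_unit_ring, 'm, 'e::topological_ab_group_add) manifold_data"
    and N :: "('k, 'n, 'f::topological_ab_group_add) manifold_data"
    and M' :: "('k, 'm2, 'e2::topological_ab_group_add) manifold_data"
    and N' :: "('k, 'n2, 'f2::topological_ab_group_add) manifold_data"
  assumes M: "charted M" "module (mscale M)" and N: "charted N" "module (mscale N)"
    and M': "charted M'" "module (mscale M')" and N': "charted N'" "module (mscale N')"
    and f: "smooth_map M N f" and g: "smooth_map M' N' g"
  shows "smooth_map (prod_manifold M M') (prod_manifold N N') (map_prod f g)"
  unfolding smooth_map_iff[OF charted_prod_manifold[OF M(1) M'(1)] charted_prod_manifold[OF N(1) N'(1)]]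
proof (intro conjI ballI impI)
  show "continuous_map (mtop (prod_manifold M M')) (mtop (prod_manifold N N')) (map_prod f g)"
    unfolding prod_manifold_simps map_prod_def continuous_map_prod_top
    using smooth_map_continuous[OF f] smooth_map_continuous[OF g] by blast
  fix cc dd z assume cc': "cc \<in> atlas (prod_manifold M M')" and dd': "dd \<in> atlas (prod_manifold N N')"
    and z: "z \<in> fst cc" "map_prod f g z \<in> fst dd"
  obtain c c' where cc: "cc = (fst c \<times> fst c', map_prod (snd c) (snd c'))"
    and ac: "c \<in> atlas M" "c' \<in> atlas M'"
    using cc' unfolding prod_manifold_simps by blast
  obtain d d' where dd: "dd = (fst d \<times> fst d', map_prod (snd d) (snd d'))"
    and ad: "d \<in> atlas N" "d' \<in> atlas N'"
    using dd' unfolding prod_manifold_simps by blast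
  note a = ac ad
  obtain p q where pq: "z = (p, q)" by (cases z)
  have c: "is_chart (mtop M) c" and c': "is_chart (mtop M') c'"
    using charted_is_chart M(1) M'(1) a by blast+
  have ccc: "is_chart (prod_topology (mtop M) (mtop M')) cc" unfolding cc by (rule is_chart_prod[OF c c'])
  have "smooth_at (mscale (prod_manifold M M')) (mscale (prod_manifold N N'))
     (map_prod (snd d \<circ> f \<circ> chart_inv c) (snd d' \<circ> g \<circ> chart_inv c')) (snd c p, snd c' q)"
    unfolding prod_manifold_simps
    by (rule smooth_at_map_prod[OF M(2) M'(2) N(2) N'(2)
          smooth_mapD[OF M(1) N(1) f a(1,3)] smooth_mapD[OF M'(1) N'(1) g a(2,4)]])
      (use z in \<open>simp_all add: pq cc dd\<close>)
  then have "smooth_at (mscale (prod_manifold M M')) (mscale (prod_manifold N N'))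
     (map_prod (snd d \<circ> f \<circ> chart_inv c) (snd d' \<circ> g \<circ> chart_inv c')) (snd cc z)"
    by (simp add: cc pq)
  then show "smooth_at (mscale (prod_manifold M M')) (mscale (prod_manifold N N'))
     (snd dd \<circ> map_prod f g \<circ> chart_inv cc) (snd cc z)"
  proof (rule smooth_at_cong_chart[OF ccc, where S = "fst cc", rotated 4])
    show "openin (prod_topology (mtop M) (mtop M')) (fst cc)" using ccc by (simp add: is_chart_def)
    fix y assume y: "y \<in> fst cc"
    show "map_prod (snd d \<circ> f \<circ> chart_inv c) (snd d' \<circ> g \<circ> chart_inv c') (snd cc y) =
         (snd dd \<circ> map_prod f g \<circ> chart_inv cc) (snd cc y)"
    proof -
      obtain r s where rs: "y = (r, s)" "r \<in> fst c" "s \<in> fst c'" using y cc by auto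
      have "chart_inv cc (snd cc y) = y" by (rule chart_inv_chart[OF ccc y])
      moreover have "snd cc y = (snd c r, snd c' s)" by (simp add: cc rs)
      ultimately show ?thesis
        using chart_inv_chart[OF c rs(2)] chart_inv_chart[OF c' rs(3)] by (simp add: dd rs(1))
    qed
  qed (use z in auto)
qed

lemma smooth_map_linear:
  assumes "continuous_on UNIV l" "\<And>x y. l (x + y) = l x + l y" "\<And>t x. l (sE t x) = sF t (l x)"
  shows "smooth_map (module_manifold sE) (module_manifold sF) l"
  unfolding smooth_map_iff[OF charted_module_manifold charted_module_manifold]
  using smooth_at_linear[where l=l and sE=sE and sF=sF, OF assms] assms(1) by auto

section \<open>Symmetric bundles\<close>

lemma is_zero_if_add_self:
  assumes "module_on S z add s" "x \<in> S" "add x x = x"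
  shows "x = z"
proof -
  obtain y where "y \<in> S" "add x y = z" using assms unfolding module_on_def by blast
  then show ?thesis using assms unfolding module_on_def by metis
qed

lemma module_on_scale_zero_right:
  assumes "module_on S z add s"
  shows "s a z = z"
  by (rule is_zero_if_add_self[OF assms]) (use assms in \<open>simp_all add: module_on_def\<close>, metis)

lemma module_on_scale_zero_left:
  assumes "module_on S z add s" "x \<in> S"
  shows "s 0 x = z"
  by (rule is_zero_if_add_self[OF assms(1)]) (use assms in \<open>simp_all add: module_on_def\<close>, metis add_0)

lemma module_on_add_uminus:
  assumes "module_on S z add s" "x \<in> S"
  shows "add x (s (- 1) x) = z"
proof -
  have "add (s 1 x) (s (- 1) x) = s (1 + - 1) x" using assms unfolding module_on_def by metis
  then show ?thesis using module_on_scale_zero_left[OF assms] assms by (simp add: module_on_def)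
qed

lemma module_on_zero_add: "module_on S z add s \<Longrightarrow> x \<in> S \<Longrightarrow> add z x = x"
  and module_on_add_commute: "module_on S z add s \<Longrightarrow> x \<in> S \<Longrightarrow> y \<in> S \<Longrightarrow> add x y = add y x"
  and module_on_add_assoc: "module_on S z add s \<Longrightarrow> x \<in> S \<Longrightarrow> y \<in> S \<Longrightarrow> w \<in> S \<Longrightarrow>
    add (add x y) w = add x (add y w)"
  unfolding module_on_def by metis+

locale symmetric_bundle_space =
  fixes sV :: "'k::dense_unit_ring \<Rightarrow> 'v \<Rightarrow> 'v::{topological_ab_group_add,t2_space}"
    and F :: "('k, 'f, 'g::{topological_ab_group_add,t2_space}) manifold_data"
    and \<mu> :: "'f \<Rightarrow> 'f \<Rightarrow> 'f"
    and M :: "('k, 'm, 'e::{topological_ab_group_add,t2_space}) manifold_data"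
    and \<mu>M :: "'m \<Rightarrow> 'm \<Rightarrow> 'm"
    and \<pi> :: "'f \<Rightarrow> 'm"
    and B :: "('k, 'm, 'f) fibre_ops"
  assumes symmetric_bundle: "symmetric_bundle sV F \<mu> M \<mu>M \<pi> B"
begin

abbreviation zero ("\<zero>") where "\<zero> p \<equiv> fzero B p"
abbreviation add (infixl "\<oplus>" 65) where "v \<oplus> w \<equiv> fadd B v w"
abbreviation scale (infixr "\<cdot>" 75) where "a \<cdot> v \<equiv> fscale B a v"
abbreviation E where "E \<equiv> fibre F \<pi>"

lemma vector_bundle: "vector_bundle sV F M \<pi> B"
  and symF: "symmetric_space F \<mu>" and symM: "symmetric_space M \<mu>M"
  and hom: "symmetric_hom F \<mu> M \<mu>M \<pi>"
  using symmetric_bundle by (simp_all add: symmetric_bundle_def)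

lemma manifolds: "manifold F" "manifold M" and tV: "topological_module sV"
  using vector_bundle by (simp_all add: vector_bundle_def)

lemma charted_spaces: "charted F" "charted M"
  using manifolds manifold_charted by auto

lemma topological_modules: "topological_module (mscale F)" "topological_module (mscale M)"
  using manifolds by (simp_all add: manifold_def)

lemma modules: "module (mscale F)" "module (mscale M)" "module sV"
  using topological_modules tV by (simp_all add: topological_module_def)

lemma fibre_module: "p \<in> mspace M \<Longrightarrow> module_on (E p) (\<zero> p) (fadd B) (fscale B)"
  using vector_bundle by (simp add: vector_bundle_def)

lemma reflF: "reflection_space F \<mu>" and reflM: "reflection_space M \<mu>M"
  using symF symM by (simp_all add: symmetric_space_def)

lemma proj_continuous: "continuous_map (mtop F) (mtop M) \<pi>"
  using hom by (simp add: symmetric_hom_def smooth_map_def)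

lemma proj_in: "v \<in> mspace F \<Longrightarrow> \<pi> v \<in> mspace M"
  using proj_continuous by (auto simp: continuous_map_def Pi_iff)

lemma smooth_mult: "smooth_map (prod_manifold F F) F (\<lambda>(x, y). \<mu> x y)"
  using reflF by (simp add: reflection_space_def)

lemma mult_in: "v \<in> mspace F \<Longrightarrow> w \<in> mspace F \<Longrightarrow> \<mu> v w \<in> mspace F"
  using smooth_map_continuous[OF smooth_mult] by (auto simp: continuous_map_def Pi_iff)

lemma proj_mult: "v \<in> mspace F \<Longrightarrow> w \<in> mspace F \<Longrightarrow> \<pi> (\<mu> v w) = \<mu>M (\<pi> v) (\<pi> w)"
  using hom by (simp add: symmetric_hom_def)

lemma base_idem: "p \<in> mspace M \<Longrightarrow> \<mu>M p p = p"
  and base_invol: "p \<in> mspace M \<Longrightarrow> q \<in> mspace M \<Longrightarrow> \<mu>M p (\<mu>M p q) = q"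
  using reflM by (simp_all add: reflection_space_def)

lemma mult_idem: "v \<in> mspace F \<Longrightarrow> \<mu> v v = v"
  and mult_invol: "v \<in> mspace F \<Longrightarrow> w \<in> mspace F \<Longrightarrow> \<mu> v (\<mu> v w) = w"
  and mult_distrib: "u \<in> mspace F \<Longrightarrow> v \<in> mspace F \<Longrightarrow> w \<in> mspace F \<Longrightarrow>
    \<mu> u (\<mu> v w) = \<mu> (\<mu> u v) (\<mu> u w)"
  using reflF by (simp_all add: reflection_space_def)

lemma fibreI: "v \<in> mspace F \<Longrightarrow> v \<in> E (\<pi> v)"
  by (simp add: fibre_def)

lemma fibreD: "v \<in> E p \<Longrightarrow> v \<in> mspace F" "v \<in> E p \<Longrightarrow> \<pi> v = p"
  by (auto simp: fibre_def)

lemma fibre_base: "v \<in> E p \<Longrightarrow> p \<in> mspace M"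
  using fibreD proj_in by blast

lemma zero_in: "p \<in> mspace M \<Longrightarrow> \<zero> p \<in> E p"
  using fibre_module by (simp add: module_on_def)

lemma scale_in: "v \<in> E p \<Longrightarrow> a \<cdot> v \<in> E p"
  using fibre_module[OF fibre_base] by (simp add: module_on_def)

lemma add_in: "v \<in> E p \<Longrightarrow> w \<in> E p \<Longrightarrow> v \<oplus> w \<in> E p"
  using fibre_module[OF fibre_base] by (simp add: module_on_def)

lemma mult_fibre: "v \<in> E p \<Longrightarrow> w \<in> E q \<Longrightarrow> \<mu> v w \<in> E (\<mu>M p q)"
  using mult_in proj_mult by (auto simp: fibre_def)

lemma mult_add:
  assumes "v \<in> E p" "v' \<in> E p" "w \<in> E q" "w' \<in> E q"
  shows "\<mu> (v \<oplus> v') (w \<oplus> w') = \<mu> v w \<oplus> \<mu> v' w'"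
  using symmetric_bundle assms fibre_base[OF assms(1)] fibre_base[OF assms(3)]
  unfolding symmetric_bundle_def by blast

lemma mult_scale:
  assumes "v \<in> E p" "w \<in> E q"
  shows "\<mu> (a \<cdot> v) (a \<cdot> w) = a \<cdot> \<mu> v w"
  using symmetric_bundle assms fibre_base[OF assms(1)] fibre_base[OF assms(2)]
  unfolding symmetric_bundle_def by blast

lemma scale_zero: "p \<in> mspace M \<Longrightarrow> a \<cdot> \<zero> p = \<zero> p"
  by (rule module_on_scale_zero_right[OF fibre_module])

lemma zero_scale: "v \<in> E p \<Longrightarrow> 0 \<cdot> v = \<zero> p"
  by (rule module_on_scale_zero_left[OF fibre_module[OF fibre_base]])

lemma add_uminus: "v \<in> E p \<Longrightarrow> v \<oplus> (- 1) \<cdot> v = \<zero> p"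
  by (rule module_on_add_uminus[OF fibre_module[OF fibre_base]])

lemma scale_add: "v \<in> E p \<Longrightarrow> w \<in> E p \<Longrightarrow> a \<cdot> (v \<oplus> w) = a \<cdot> v \<oplus> a \<cdot> w"
  and scale_scale: "v \<in> E p \<Longrightarrow> a \<cdot> b \<cdot> v = (a * b) \<cdot> v"
  and scale_one: "v \<in> E p \<Longrightarrow> 1 \<cdot> v = v"
  using fibre_module[OF fibre_base, of v p] by (simp_all add: module_on_def)

lemma zero_add: "v \<in> E p \<Longrightarrow> \<zero> p \<oplus> v = v"
  by (rule module_on_zero_add[OF fibre_module[OF fibre_base]])

lemma add_commute: "v \<in> E p \<Longrightarrow> w \<in> E p \<Longrightarrow> v \<oplus> w = w \<oplus> v"
  by (rule module_on_add_commute[OF fibre_module[OF fibre_base]])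

lemma add_assoc:
  "v \<in> E p \<Longrightarrow> w \<in> E p \<Longrightarrow> x \<in> E p \<Longrightarrow> (v \<oplus> w) \<oplus> x = v \<oplus> (w \<oplus> x)"
  by (rule module_on_add_assoc[OF fibre_module[OF fibre_base]])

lemma uminus_uminus: "v \<in> E p \<Longrightarrow> (- 1) \<cdot> (- 1) \<cdot> v = v"
  using scale_scale[of v p "- 1" "- 1"] scale_one[of v p] by simp

text \<open>Zero vectors are the multiples by the scalar \<open>0\<close>, and \<open>\<mu>\<close> is homogeneous.\<close>

lemma mult_zero_zero:
  assumes "p \<in> mspace M" "q \<in> mspace M"
  shows "\<mu> (\<zero> p) (\<zero> q) = \<zero> (\<mu>M p q)"
  using mult_scale[OF zero_in[OF assms(1)] zero_in[OF assms(2)], of 0]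
    zero_scale[OF mult_fibre[OF zero_in[OF assms(1)] zero_in[OF assms(2)]]] scale_zero assms by simp

lemma zero_mult_scale:
  assumes "p \<in> mspace M" "w \<in> E q"
  shows "\<mu> (\<zero> p) (a \<cdot> w) = a \<cdot> \<mu> (\<zero> p) w"
  using mult_scale[OF zero_in[OF assms(1)] assms(2), of a] scale_zero[OF assms(1)] by simp

text \<open>Additivity of \<open>\<mu>\<close> for \<open>(v, w) = (v, 0) + (0, w)\<close>.\<close>

lemma mult_split:
  assumes "v \<in> E p" "w \<in> E q"
  shows "\<mu> v w = \<mu> v (\<zero> q) \<oplus> \<mu> (\<zero> p) w"
proof -
  have p: "p \<in> mspace M" and q: "q \<in> mspace M" using assms fibre_base by auto
  have "v \<oplus> \<zero> p = v" using add_commute[OF assms(1) zero_in[OF p]] zero_add[OF assms(1)] by simp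
  then show ?thesis
    using mult_add[OF assms(1) zero_in[OF p] zero_in[OF q] assms(2)] zero_add[OF assms(2)] by simp
qed

section \<open>The vertical symmetry\<close>

text \<open>With \<open>h = u/2\<close>, \<open>a = \<mu> h 0\<^sub>q\<close> and \<open>b = \<mu> 0\<^sub>p w\<close>, the splitting of \<open>\<mu>\<close> gives \<open>\<mu> h w = a + b\<close>. The next two
factors turn this into \<open>x = \<mu> 0\<^sub>p (- a - b)\<close>, a vector over \<open>q\<close> again, and
\<open>\<mu> h x = a + \<mu> 0\<^sub>p x = a - a - b\<close> because the symmetry at \<open>0\<^sub>p\<close> is an involution.\<close>

lemma vertical_symmetry_eq:
  assumes u: "u \<in> mspace F" and w: "w \<in> mspace F"
  shows "vertical_symmetry \<mu> \<pi> B u w = (- 1) \<cdot> \<mu> (\<zero> (\<pi> u)) w"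
proof -
  define p q h where "p = \<pi> u" "q = \<pi> w" "h = half \<cdot> u"
  have uE: "u \<in> E p" and wE: "w \<in> E q" using u w by (auto simp: p_q_h_def fibreI)
  have p: "p \<in> mspace M" and q: "q \<in> mspace M" using uE wE fibre_base by auto
  have h: "h \<in> E p" using scale_in[OF uE] by (simp add: p_q_h_def)
  let ?r = "\<mu>M p q"
  have pr: "\<mu>M p ?r = q" by (rule base_invol[OF p q])
  define a b where "a = \<mu> h (\<zero> q)" "b = \<mu> (\<zero> p) w"
  have a: "a \<in> E ?r" and b: "b \<in> E ?r"
    using mult_fibre h wE zero_in p q by (auto simp: a_b_def)
  have na: "(- 1) \<cdot> a \<in> E ?r" and nb: "(- 1) \<cdot> b \<in> E ?r" using scale_in a b by auto
  have inv: "\<mu> (\<zero> p) (\<mu> (\<zero> p) x) = x" if "x \<in> E s" for x s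
    using mult_invol zero_in[OF p] that fibreD by blast
  have "\<mu> h w = a \<oplus> b" using mult_split[OF h wE] by (simp add: a_b_def)
  then have 1: "(- 1) \<cdot> \<mu> h w = (- 1) \<cdot> a \<oplus> (- 1) \<cdot> b" using scale_add[OF a b] by simp
  have nn: "(- 1) \<cdot> a \<oplus> (- 1) \<cdot> b \<in> E ?r" by (rule add_in[OF na nb])
  define x where "x = \<mu> (\<zero> p) ((- 1) \<cdot> a \<oplus> (- 1) \<cdot> b)"
  have x: "x \<in> E q" using mult_fibre[OF zero_in[OF p] nn] pr by (simp add: x_def)
  have "\<mu> h x = a \<oplus> \<mu> (\<zero> p) x" using mult_split[OF h x] by (simp add: a_b_def)
  also have "\<mu> (\<zero> p) x = (- 1) \<cdot> a \<oplus> (- 1) \<cdot> b" unfolding x_def by (rule inv[OF nn])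
  also have "a \<oplus> ((- 1) \<cdot> a \<oplus> (- 1) \<cdot> b) = (a \<oplus> (- 1) \<cdot> a) \<oplus> (- 1) \<cdot> b"
    by (rule add_assoc[OF a na nb, symmetric])
  also have "\<dots> = (- 1) \<cdot> b" using add_uminus[OF a] zero_add[OF nb] by simp
  finally have "\<mu> h x = (- 1) \<cdot> b" .
  then show ?thesis by (simp add: vertical_symmetry_def 1 x_def a_b_def p_q_h_def[symmetric])
qed

section \<open>Local trivializations and smoothness of scalar multiplication\<close>

text \<open>The inverse \<open>\<Psi>\<close> is named alongside \<open>\<Phi>\<close> because smoothness of the inclusion of a fibre is read off from it.\<close>

lemma trivialization:
  assumes p: "p \<in> mspace M"
  obtains U \<Phi> \<Psi> S where "openin (mtop M) U" "p \<in> U" "S = {v \<in> mspace F. \<pi> v \<in> U}" "openin (mtop F) S"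
    "smooth_map (open_submanifold F S) (prod_manifold (open_submanifold M U) (module_manifold sV)) \<Phi>"
    "smooth_map (prod_manifold (open_submanifold M U) (module_manifold sV)) (open_submanifold F S) \<Psi>"
    "\<And>v. v \<in> S \<Longrightarrow> fst (\<Phi> v) = \<pi> v" "\<And>v. v \<in> S \<Longrightarrow> \<Psi> (\<Phi> v) = v"
    "\<And>q y. q \<in> U \<Longrightarrow> \<Psi> (q, y) \<in> E q \<and> \<Phi> (\<Psi> (q, y)) = (q, y)"
    "\<And>v a. v \<in> S \<Longrightarrow> snd (\<Phi> (a \<cdot> v)) = sV a (snd (\<Phi> v))"
proof -
  obtain U \<Phi> where pU: "p \<in> U" and triv: "local_trivialization sV F M \<pi> B U \<Phi>"
    using vector_bundle p unfolding vector_bundle_def by blast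
  define S where "S = {v \<in> mspace F. \<pi> v \<in> U}"
  have U: "openin (mtop M) U"
    and diff: "diffeomorphism (open_submanifold F S) (prod_manifold (open_submanifold M U) (module_manifold sV)) \<Phi>"
    using triv by (simp_all add: local_trivialization_def S_def)
  have S: "openin (mtop F) S"
    unfolding S_def by (rule openin_continuous_map_preimage[OF proj_continuous U])
  have tS: "mspace (open_submanifold F S) = S" by (auto simp: S_def)
  have UM: "U \<subseteq> mspace M" using U openin_subset by blast
  then have tP: "mspace (prod_manifold (open_submanifold M U) (module_manifold sV)) = U \<times> UNIV"
    by auto
  define \<Psi> where "\<Psi> = inv_into S \<Phi>"
  have bij: "bij_betw \<Phi> S (U \<times> UNIV)" and s\<Phi>: "smooth_map (open_submanifold F S) (prod_manifold (open_submanifold M U) (module_manifold sV)) \<Phi>"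
    and s\<Psi>: "smooth_map (prod_manifold (open_submanifold M U) (module_manifold sV)) (open_submanifold F S) \<Psi>"
    using diff unfolding diffeomorphism_def tS tP \<Psi>_def by auto
  have fst: "fst (\<Phi> v) = \<pi> v" if "v \<in> S" for v
    using triv that unfolding local_trivialization_def S_def by (simp add: fibre_def)
  have lin: "snd (\<Phi> (a \<cdot> v)) = sV a (snd (\<Phi> v))" if "v \<in> S" for a v
  proof -
    have "\<pi> v \<in> U" "v \<in> E (\<pi> v)" using that by (auto simp: S_def fibre_def)
    then show ?thesis using triv unfolding local_trivialization_def by blast
  qed
  have left: "\<Psi> (\<Phi> v) = v" if "v \<in> S" for v
    unfolding \<Psi>_def using bij that by (rule bij_betw_inv_into_left)
  have right: "\<Psi> (q, y) \<in> E q \<and> \<Phi> (\<Psi> (q, y)) = (q, y)" if "q \<in> U" for q y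
  proof -
    have 1: "\<Phi> (\<Psi> (q, y)) = (q, y)"
      unfolding \<Psi>_def using bij by (rule bij_betw_inv_into_right) (use that in simp)
    have "\<Psi> (q, y) \<in> S"
      unfolding \<Psi>_def by (rule inv_into_into) (use bij that in \<open>auto simp: bij_betw_def\<close>)
    then show ?thesis using 1 fst[of "\<Psi> (q, y)"] by (simp add: S_def fibre_def)
  qed
  show ?thesis by (rule that[OF U pU S_def S s\<Phi> s\<Psi> fst left right lin])
qed

text \<open>In a local trivialization scalar multiplication is \<open>id \<times> sV a\<close>, and continuous linear maps are smooth.\<close>

lemma smooth_scale: "smooth_map F F (fscale B a)"
proof (rule smooth_map_local[OF charted_spaces(1) charted_spaces(1)])
  fix v assume v: "v \<in> mspace F"
  obtain U \<Phi> \<Psi> S where triv: "openin (mtop M) U" "\<pi> v \<in> U" "S = {v \<in> mspace F. \<pi> v \<in> U}" "openin (mtop F) S"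
    "smooth_map (open_submanifold F S) (prod_manifold (open_submanifold M U) (module_manifold sV)) \<Phi>"
    "smooth_map (prod_manifold (open_submanifold M U) (module_manifold sV)) (open_submanifold F S) \<Psi>"
    "\<And>v. v \<in> S \<Longrightarrow> fst (\<Phi> v) = \<pi> v" "\<And>v. v \<in> S \<Longrightarrow> \<Psi> (\<Phi> v) = v"
    "\<And>v a. v \<in> S \<Longrightarrow> snd (\<Phi> (a \<cdot> v)) = sV a (snd (\<Phi> v))"
    by (rule trivialization[OF proj_in[OF v]]) (rule that; assumption)
  let ?P = "prod_manifold (open_submanifold M U) (module_manifold sV)"
  let ?S = "open_submanifold F S"
  have cU: "charted (open_submanifold M U)" and cS: "charted ?S"
    using charted_spaces charted_open_submanifold triv(1,4) by auto
  have cP: "charted ?P" by (rule charted_prod_manifold[OF cU charted_module_manifold])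
  have mP: "module (mscale ?P)" using module_map_prod modules by simp
  interpret V: module sV by (rule modules(3))
  have "continuous_on UNIV (\<lambda>(a, x). sV a x)" using tV by (simp add: topological_module_def)
  then have "continuous_on UNIV ((\<lambda>(a, x). sV a x) \<circ> (\<lambda>x. (a, x)))"
    by (intro continuous_on_compose[OF _ continuous_on_subset[of UNIV]] continuous_on_Pair
        continuous_on_id continuous_on_const) auto
  then have "continuous_on UNIV (sV a)" by (simp add: o_def)
  then have sa: "smooth_map (module_manifold sV) (module_manifold sV) (sV a)"
    by (rule smooth_map_linear) (auto simp: V.scale_right_distrib mult.commute)
  have "smooth_map ?P ?P (map_prod id (sV a))"
    by (rule smooth_map_map_prod[OF cU _ cU _ charted_module_manifold _ charted_module_manifold _
          smooth_map_id_open_submanifold[OF manifolds(2) triv(1)] sa]) (simp_all add: modules)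
  from smooth_map_compose[OF cS _ cP mP cP mP triv(5) this]
  have "smooth_map ?S ?P (map_prod id (sV a) \<circ> \<Phi>)" by (simp add: modules)
  from smooth_map_compose[OF cS _ cP mP cS _ this triv(6)]
  have "smooth_map ?S ?S (\<Psi> \<circ> (map_prod id (sV a) \<circ> \<Phi>))" by (simp add: modules)
  then have "smooth_map ?S ?S (fscale B a)"
  proof (rule smooth_map_cong[OF cS cS])
    fix w assume "w \<in> mspace ?S"
    then have w: "w \<in> S" by simp
    then have wE: "w \<in> E (\<pi> w)" and \<pi>w: "\<pi> w \<in> U" unfolding triv(3) by (auto intro: fibreI)
    have aw: "a \<cdot> w \<in> E (\<pi> w)" by (rule scale_in[OF wE])
    then have awS: "a \<cdot> w \<in> S" using \<pi>w unfolding triv(3) by (auto simp: fibre_def)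
    have "map_prod id (sV a) (\<Phi> w) = \<Phi> (a \<cdot> w)"
      using triv(7)[OF w] triv(7)[OF awS] triv(9)[OF w] fibreD(2)[OF aw] by (simp add: prod_eq_iff)
    then show "(\<Psi> \<circ> (map_prod id (sV a) \<circ> \<Phi>)) w = a \<cdot> w" using triv(8)[OF awS] by simp
  qed
  then show "\<exists>U V. openin (mtop F) U \<and> v \<in> U \<and> openin (mtop F) V \<and>
       smooth_map (open_submanifold F U) (open_submanifold F V) (fscale B a)"
    using triv(2,3,4) v by blast
qed

section \<open>The symmetry at a zero vector along its fibre\<close>

text \<open>Axiom (S4) at \<open>0\<^sub>p\<close> in terms of one chart \<open>d\<close>: it is evaluated at the tangent vector represented by
\<open>(d, w)\<close>, whose only representative with chart \<open>d\<close> is \<open>w\<close> itself, because the transition map from \<open>d\<close> to \<open>d\<close> is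
the identity.\<close>

lemma differential_symmetry_at_zero:
  assumes p: "p \<in> mspace M" and d: "d \<in> charts_at F (\<zero> p)"
    and s: "smooth_at (mscale F) (mscale F) (snd d \<circ> \<mu> (\<zero> p) \<circ> chart_inv d) (snd d (\<zero> p))"
  shows "has_directional_derivative (mscale F) (mscale F)
    (snd d \<circ> \<mu> (\<zero> p) \<circ> chart_inv d) (snd d (\<zero> p)) w (- w)"
proof -
  let ?z = "\<zero> p" and ?s = "mscale F"
  let ?D = "\<lambda>f. differential ?s ?s f (snd d ?z)"
  have dF: "is_chart (mtop F) d" "?z \<in> fst d"
    using d charted_is_chart[OF charted_spaces(1)] by (auto simp: charts_at_def)
  have id: "?D (snd d \<circ> chart_inv d) w = w"
  proof (rule differential_eq[OF topological_modules(1) modules(1)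
        has_directional_derivative_locally_id[OF topological_modules(1)]])
    show "open (snd d ` fst d)" using dF by (simp add: is_chart_def)
  qed (use dF chart_inv_chart[OF dF(1)] in auto)
  define \<xi> where "\<xi> = tangent_rel F ?z `` {(d, w)}"
  have mem: "(d, v) \<in> \<xi> \<longleftrightarrow> v = w" for v
  proof -
    have "((d, w), (d, v)) \<in> tangent_rel F ?z \<longleftrightarrow>
        d \<in> charts_at F ?z \<and> v = ?D (snd d \<circ> chart_inv d) w"
      unfolding tangent_rel_def by blast
    then show ?thesis using d id by (simp add: \<xi>_def)
  qed
  have "\<xi> \<in> tangent_space F ?z"
    unfolding tangent_space_def \<xi>_def by (rule quotientI) (use d in simp)
  then have eq: "tangent_map F F (\<mu> ?z) ?z \<xi> = tangent_uminus \<xi>"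
    using symF fibreD(1)[OF zero_in[OF p]] by (simp add: symmetric_space_def)
  have "(d, ?D (snd d \<circ> \<mu> ?z \<circ> chart_inv d) w) \<in> tangent_map F F (\<mu> ?z) ?z \<xi>"
    unfolding tangent_map_def using mem[of w] d mult_idem[OF fibreD(1)[OF zero_in[OF p]]]
    by (intro CollectI exI[of _ d] exI[of _ w]) auto
  then have "?D (snd d \<circ> \<mu> ?z \<circ> chart_inv d) w = - w"
    unfolding eq using mem by (auto simp: tangent_uminus_def)
  then show ?thesis
    using has_directional_derivative_differential[OF topological_modules(1) modules(1) s, of w] by simp
qed

text \<open>Let \<open>\<gamma>\<close> be the inclusion of the fibre over \<open>p\<close> into \<open>F\<close>, \<open>\<sigma>\<close> the symmetry at \<open>0\<^sub>p\<close> and \<open>\<rho>\<close> the projection of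
a trivialization onto the typical fibre, all read in the typical fibre and in a chart of \<open>F\<close> at \<open>0\<^sub>p\<close>. Then
\<open>\<rho> \<circ> \<gamma> = id\<close> near \<open>0\<close>, while \<open>\<rho> \<circ> \<sigma> \<circ> \<gamma>\<close> is the expression \<open>A\<close> of the symmetry in the typical fibre. In
direction \<open>y\<close>, with \<open>w = d\<gamma>(y)\<close>, the chain rule and (S4) give \<open>dA(y) = d\<rho>(-w) = -d\<rho>(w) = -y\<close>; and
\<open>dA(y) = A y\<close> since \<open>A\<close> is homogeneous.\<close>

lemma zero_mult_fibre:
  assumes uE: "u \<in> E p"
  shows "\<mu> (\<zero> p) u = (- 1) \<cdot> u"
proof -
  have p: "p \<in> mspace M" using fibre_base[OF uE] .
  let ?z = "\<zero> p"
  have zE: "?z \<in> E p" by (rule zero_in[OF p])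
  obtain U \<Phi> \<Psi> S where triv: "openin (mtop M) U" "p \<in> U" "S = {v \<in> mspace F. \<pi> v \<in> U}" "openin (mtop F) S"
    "smooth_map (open_submanifold F S) (prod_manifold (open_submanifold M U) (module_manifold sV)) \<Phi>"
    "smooth_map (prod_manifold (open_submanifold M U) (module_manifold sV)) (open_submanifold F S) \<Psi>"
    "\<And>v. v \<in> S \<Longrightarrow> fst (\<Phi> v) = \<pi> v" "\<And>v. v \<in> S \<Longrightarrow> \<Psi> (\<Phi> v) = v"
    "\<And>q y. q \<in> U \<Longrightarrow> \<Psi> (q, y) \<in> E q \<and> \<Phi> (\<Psi> (q, y)) = (q, y)"
    "\<And>v a. v \<in> S \<Longrightarrow> snd (\<Phi> (a \<cdot> v)) = sV a (snd (\<Phi> v))"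
    by (rule trivialization[OF p]) (rule that; assumption)
  let ?P = "prod_manifold (open_submanifold M U) (module_manifold sV)"
  let ?S = "open_submanifold F S"
  interpret V: module sV by (rule modules(3))
  have cU: "charted (open_submanifold M U)" and cS: "charted ?S"
    using charted_spaces charted_open_submanifold triv(1,4) by auto
  have cP: "charted ?P" by (rule charted_prod_manifold[OF cU charted_module_manifold])
  have mP: "module (mscale ?P)" using module_map_prod modules by simp
  have ES: "v \<in> S" if "v \<in> E p" for v using that triv(2,3) by (auto simp: fibre_def)
  define j where "j y = \<Psi> (p, y)" for y
  define y where "y = snd (\<Phi> u)"
  have jE: "j x \<in> E p" and \<Phi>j: "\<Phi> (j x) = (p, x)" for x
    using triv(9)[OF triv(2), of x] by (auto simp: j_def)
  have jS: "j x \<in> S" for x by (rule ES[OF jE])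
  have j_snd: "j (snd (\<Phi> v)) = v" if "v \<in> E p" for v
  proof -
    have "(p, snd (\<Phi> v)) = \<Phi> v" using triv(7)[OF ES[OF that]] fibreD(2)[OF that] by (simp add: prod_eq_iff)
    then show ?thesis using triv(8)[OF ES[OF that]] by (simp add: j_def)
  qed
  have j_scale: "j (sV t x) = t \<cdot> j x" for t x
    using j_snd[OF scale_in[OF jE], of t x] triv(10)[OF jS, of t x] \<Phi>j[of x] by simp
  have j0: "j 0 = ?z"
    by (rule trans[OF j_scale[of 0 0, unfolded V.scale_zero_left] zero_scale[OF jE]])
  define A where "A x = snd (\<Phi> (\<mu> ?z (j x)))" for x
  have \<sigma>E: "\<mu> ?z v \<in> E p" if "v \<in> E p" for v
    using mult_fibre[OF zE that] base_idem[OF p] by simp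
  have A_scale: "A (sV t x) = sV t (A x)" for t x
    unfolding A_def j_scale zero_mult_scale[OF p jE] by (rule triv(10)[OF ES[OF \<sigma>E[OF jE]]])

  obtain c where c: "c \<in> atlas M" "p \<in> fst c" using charted_spaces(2) p unfolding charted_def by blast
  obtain d where d: "d \<in> atlas F" "?z \<in> fst d"
    using charted_spaces(1) fibreD(1)[OF zE] unfolding charted_def by blast
  have cM: "is_chart (mtop M) c" and dF: "is_chart (mtop F) d"
    by (rule charted_is_chart[OF charted_spaces(2) c(1)], rule charted_is_chart[OF charted_spaces(1) d(1)])
  let ?d = "(fst d \<inter> S, snd d)"
  let ?c = "((fst c \<inter> U) \<times> (UNIV :: 'v set), map_prod (snd c) (id :: 'v \<Rightarrow> 'v))"
  let ?x = "snd d ?z"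
  have dS: "?d \<in> atlas ?S" using d unfolding open_submanifold_simps by blast
  have cPa: "?c \<in> atlas ?P"
    unfolding prod_manifold_simps
  proof (intro CollectI exI conjI)
    show "?c = (fst (fst c \<inter> U, snd c) \<times> fst (UNIV, id), map_prod (snd (fst c \<inter> U, snd c)) (snd (UNIV, id)))"
      by simp
    show "(fst c \<inter> U, snd c) \<in> atlas (open_submanifold M U)"
      using c(1) unfolding open_submanifold_simps by blast
  qed simp
  have cPc: "is_chart (mtop ?P) ?c" by (rule charted_is_chart[OF cP cPa])
  have inv_c: "chart_inv ?c (snd c p, x) = (p, x)" for x
    using chart_inv_chart[OF cPc, of "(p, x)"] c(2) triv(2) by simp

  define \<gamma> where "\<gamma> = snd d \<circ> j"
  define \<sigma> where "\<sigma> = snd d \<circ> \<mu> ?z \<circ> chart_inv d"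
  define \<rho> where "\<rho> = snd \<circ> \<Phi> \<circ> chart_inv d"
  have smooth_\<gamma>: "smooth_at sV (mscale F) \<gamma> 0"
  proof -
    have "smooth_at (mscale ?P) (mscale ?S) (snd ?d \<circ> \<Psi> \<circ> chart_inv ?c) (snd ?c (p, 0))"
      by (rule smooth_mapD[OF cP cS triv(6) cPa dS]) (use c triv(2) j0 d ES[OF zE] in \<open>auto simp: j_def\<close>)
    then have 1: "smooth_at (mscale ?P) (mscale F) (snd d \<circ> \<Psi> \<circ> chart_inv ?c) (snd c p, 0)" by simp
    have 2: "smooth_at sV (mscale ?P) (\<lambda>x. (snd c p, id x)) 0"
      unfolding prod_manifold_simps open_submanifold_simps module_manifold_simps
      by (rule smooth_at_Pair[OF smooth_at_const[OF modules(2)] smooth_at_id])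
    have "smooth_at sV (mscale F) ((snd d \<circ> \<Psi> \<circ> chart_inv ?c) \<circ> (\<lambda>x. (snd c p, id x))) 0"
      by (rule smooth_at_compose[OF modules(3) mP modules(1) 2]) (use 1 in simp)
    moreover have "(snd d \<circ> \<Psi> \<circ> chart_inv ?c) \<circ> (\<lambda>x. (snd c p, id x)) = \<gamma>"
      by (simp add: fun_eq_iff inv_c \<gamma>_def j_def)
    ultimately show ?thesis by simp
  qed
  have smooth_\<sigma>: "smooth_at (mscale F) (mscale F) \<sigma> ?x"
  proof -
    let ?dd = "(fst d \<times> fst d, map_prod (snd d) (snd d))"
    have dda: "?dd \<in> atlas (prod_manifold F F)" using d(1) unfolding prod_manifold_simps by blast
    note cFF = charted_prod_manifold[OF charted_spaces(1) charted_spaces(1)]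
    have ddc: "is_chart (mtop (prod_manifold F F)) ?dd" by (rule charted_is_chart[OF cFF dda])
    have mFF: "module (mscale (prod_manifold F F))" using module_map_prod modules by simp
    have "smooth_at (mscale (prod_manifold F F)) (mscale F) (snd d \<circ> (\<lambda>(x, y). \<mu> x y) \<circ> chart_inv ?dd) (snd ?dd (?z, ?z))"
      by (rule smooth_mapD[OF cFF charted_spaces(1) smooth_mult dda d(1)])
        (use d(2) mult_idem[OF fibreD(1)[OF zE]] in auto)
    then have 1: "smooth_at (mscale (prod_manifold F F)) (mscale F) (snd d \<circ> (\<lambda>(x, y). \<mu> x y) \<circ> chart_inv ?dd) (?x, ?x)" by simp
    have 2: "smooth_at (mscale F) (mscale (prod_manifold F F)) (\<lambda>x. (?x, id x)) ?x"
      unfolding prod_manifold_simps by (rule smooth_at_Pair[OF smooth_at_const[OF modules(1)] smooth_at_id])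
    have "smooth_at (mscale F) (mscale F) ((snd d \<circ> (\<lambda>(x, y). \<mu> x y) \<circ> chart_inv ?dd) \<circ> (\<lambda>x. (?x, id x))) ?x"
      by (rule smooth_at_compose[OF modules(1) mFF modules(1) 2]) (use 1 in simp)
    then show ?thesis
    proof (rule smooth_at_cong_chart[OF dF, where S = "fst d", rotated 4])
      show "openin (mtop F) (fst d)" using dF by (simp add: is_chart_def)
      fix v assume v: "v \<in> fst d"
      show "((snd d \<circ> (\<lambda>(x, y). \<mu> x y) \<circ> chart_inv ?dd) \<circ> (\<lambda>x. (?x, id x))) (snd d v) = \<sigma> (snd d v)"
        using chart_inv_chart[OF ddc, of "(?z, v)"] chart_inv_chart[OF dF v] v d(2) by (simp add: \<sigma>_def)
    qed (use d in auto)
  qed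
  have smooth_\<rho>: "smooth_at (mscale F) sV \<rho> ?x"
  proof -
    have "smooth_at (mscale ?S) (mscale ?P) (snd ?c \<circ> \<Phi> \<circ> chart_inv ?d) (snd ?d ?z)"
      by (rule smooth_mapD[OF cS cP triv(5) dS cPa])
        (use d ES[OF zE] c(2) triv(2) \<Phi>j[of 0] j0 in auto)
    then have 1: "smooth_at (mscale F) (mscale ?P) (snd ?c \<circ> \<Phi> \<circ> chart_inv ?d) ?x" by simp
    have "smooth_at (mscale F) sV (snd \<circ> (snd ?c \<circ> \<Phi> \<circ> chart_inv ?d)) ?x"
      by (rule smooth_at_compose[OF modules(1) mP modules(3) 1]) (simp add: smooth_at_snd)
    then show ?thesis
    proof (rule smooth_at_cong_chart[OF dF, where S = "fst d \<inter> S", rotated 4])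
      show "openin (mtop F) (fst d \<inter> S)" using dF triv(4) by (auto simp: is_chart_def)
      fix v assume v: "v \<in> fst d \<inter> S"
      then show "(snd \<circ> (snd ?c \<circ> \<Phi> \<circ> chart_inv ?d)) (snd d v) = \<rho> (snd d v)"
        using chart_inv_open_submanifold[OF dF v] chart_inv_chart[OF dF, of v] by (simp add: \<rho>_def)
    qed (use d ES[OF zE] in auto)
  qed

  have j_cont: "continuous_map euclidean (mtop F) j"
  proof -
    have "continuous_map euclidean (mtop ?P) (\<lambda>x. (p, x))"
      using triv(1,2) openin_subset[OF triv(1)] by (auto simp: continuous_map_pairwise o_def)
    from continuous_map_compose[OF this smooth_map_continuous[OF triv(6)]]
    show ?thesis by (simp add: o_def j_def[abs_def] continuous_map_in_subtopology)
  qed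
  have \<sigma>_cont: "continuous_map (mtop F) (mtop F) (\<mu> ?z)"
  proof -
    have "continuous_map (mtop F) (mtop (prod_manifold F F)) (\<lambda>x. (?z, x))"
      using fibreD(1)[OF zE] by (auto simp: continuous_map_pairwise o_def)
    from continuous_map_compose[OF this smooth_map_continuous[OF smooth_mult]]
    show ?thesis by (simp add: o_def)
  qed
  have dopen: "openin (mtop F) (fst d)" using dF by (simp add: is_chart_def)
  (* On G the included point and its image under the symmetry both stay in the domain of the chart d,
     so the chart cancels against its inverse. *)
  define G where "G = {x. j x \<in> fst d} \<inter> {x. \<mu> ?z (j x) \<in> fst d}"
  have "open {x. j x \<in> fst d}"
    using openin_continuous_map_preimage[OF j_cont dopen] by simp
  moreover have "open {x. \<mu> ?z (j x) \<in> fst d}"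
    using openin_continuous_map_preimage[OF continuous_map_compose[OF j_cont \<sigma>_cont] dopen] by simp
  ultimately have G: "open G" by (simp add: G_def open_Int)
  have zz: "\<mu> ?z ?z = ?z" by (rule mult_idem[OF fibreD(1)[OF zE]])
  have G0: "0 \<in> G" using j0 zz d(2) by (simp add: G_def)
  have \<rho>\<gamma>: "\<rho> (\<gamma> x) = x" if "x \<in> G" for x
    using that chart_inv_chart[OF dF, of "j x"] \<Phi>j[of x] by (simp add: G_def \<rho>_def \<gamma>_def)
  have \<rho>\<sigma>\<gamma>: "\<rho> (\<sigma> (\<gamma> x)) = A x" if "x \<in> G" for x
    using that chart_inv_chart[OF dF, of "j x"] chart_inv_chart[OF dF, of "\<mu> ?z (j x)"]
    by (simp add: G_def \<rho>_def \<gamma>_def \<sigma>_def A_def)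
  have \<gamma>0: "\<gamma> 0 = ?x" by (simp add: \<gamma>_def j0)
  have \<sigma>x: "\<sigma> ?x = ?x" using chart_inv_chart[OF dF d(2)] zz by (simp add: \<sigma>_def)

  obtain w where w: "has_directional_derivative sV (mscale F) \<gamma> 0 y w"
    by (rule smooth_at_has_directional_derivative[OF smooth_\<gamma>])
  obtain w' where w': "has_directional_derivative (mscale F) sV \<rho> ?x w w'"
    by (rule smooth_at_has_directional_derivative[OF smooth_\<rho>])
  have "has_directional_derivative sV sV (\<rho> \<circ> \<gamma>) 0 y w'"
    by (rule has_directional_derivative_compose[OF modules(3,1) w]) (use w' \<gamma>0 in simp)
  then have "has_directional_derivative sV sV id 0 y w'"
    by (rule has_directional_derivative_cong[OF _ G G0]) (simp add: \<rho>\<gamma>)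
  then have w'y: "w' = y"
    by (rule has_directional_derivative_unique[OF tV modules(3)])
      (rule has_directional_derivative_locally_id[OF tV open_UNIV], auto)
  have dminus: "has_directional_derivative (mscale F) sV \<rho> ?x (- w) (- y)"
    using has_directional_derivative_uminus[OF topological_modules(1) modules(3) w'] w'y by simp
  have d\<sigma>: "has_directional_derivative (mscale F) (mscale F) \<sigma> ?x w (- w)"
    unfolding \<sigma>_def
    by (rule differential_symmetry_at_zero[OF p _ smooth_\<sigma>[unfolded \<sigma>_def]])
      (use d in \<open>simp add: charts_at_def\<close>)
  have "has_directional_derivative sV (mscale F) (\<sigma> \<circ> \<gamma>) 0 y (- w)"
    by (rule has_directional_derivative_compose[OF modules(3,1) w]) (use d\<sigma> \<gamma>0 in simp)
  then have "has_directional_derivative sV sV (\<rho> \<circ> (\<sigma> \<circ> \<gamma>)) 0 y (- y)"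
    by (rule has_directional_derivative_compose[OF modules(3,1)]) (use dminus \<gamma>0 \<sigma>x in simp)
  then have dA: "has_directional_derivative sV sV A 0 y (- y)"
    by (rule has_directional_derivative_cong[OF _ G G0]) (simp add: \<rho>\<sigma>\<gamma>)
  have A0: "A 0 = 0" using A_scale[of 0 0] by simp
  have "- y = A y"
    by (rule directional_derivative_eqI[OF tV modules(3) dA open_UNIV, of "\<lambda>_. A y"])
      (simp_all add: A0 A_scale)
  then have "snd (\<Phi> (\<mu> ?z u)) = snd (\<Phi> ((- 1) \<cdot> u))"
    using j_snd[OF uE] triv(10)[OF ES[OF uE], of "- 1"] by (simp add: A_def y_def)
  then show ?thesis using j_snd[OF \<sigma>E[OF uE]] j_snd[OF scale_in[OF uE]] by metis
qed

section \<open>The reflection space of vertical symmetries\<close>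

text \<open>On \<open>F \<times> F\<close> the vertical symmetry is \<open>(u, w) \<mapsto> \<mu> (0 u) ((-1) w)\<close>, because \<open>0 u\<close> is the zero vector of the
fibre of \<open>u\<close> and \<open>(-1)\<^sub>F\<close> commutes with its symmetry.\<close>

lemma smooth_vertical_symmetry:
  "smooth_map (prod_manifold F F) F (\<lambda>(x, y). vertical_symmetry \<mu> \<pi> B x y)"
proof -
  note cFF = charted_prod_manifold[OF charted_spaces(1) charted_spaces(1)]
  have mFF: "module (mscale (prod_manifold F F))" using module_map_prod modules by simp
  have "smooth_map (prod_manifold F F) (prod_manifold F F) (map_prod (fscale B 0) (fscale B (- 1)))"
    using charted_spaces(1) modules(1) smooth_scale by (intro smooth_map_map_prod)
  from smooth_map_compose[OF cFF mFF cFF mFF charted_spaces(1) modules(1) this smooth_mult]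
  show ?thesis
  proof (rule smooth_map_cong[OF cFF charted_spaces(1)])
    fix z assume "z \<in> mspace (prod_manifold F F)"
    then obtain u w where z: "z = (u, w)" and u: "u \<in> mspace F" and w: "w \<in> mspace F" by auto
    then show "((\<lambda>(x, y). \<mu> x y) \<circ> map_prod (fscale B 0) (fscale B (- 1))) z =
      (case z of (x, y) \<Rightarrow> vertical_symmetry \<mu> \<pi> B x y)"
      using vertical_symmetry_eq[OF u w] zero_scale[OF fibreI[OF u]]
        zero_mult_scale[OF proj_in[OF u] fibreI[OF w], of "- 1"] by simp
  qed
qed

lemma reflection_space_vertical_symmetry: "reflection_space F (vertical_symmetry \<mu> \<pi> B)"
proof -
  let ?n = "vertical_symmetry \<mu> \<pi> B"
  have n_fibre: "?n u w \<in> E (\<mu>M (\<pi> u) (\<pi> w))" if "u \<in> mspace F" "w \<in> mspace F" for u w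
    unfolding vertical_symmetry_eq[OF that]
    by (rule scale_in[OF mult_fibre[OF zero_in[OF proj_in[OF that(1)]] fibreI[OF that(2)]]])
  have n_in: "?n u w \<in> mspace F" and n_proj: "\<pi> (?n u w) = \<mu>M (\<pi> u) (\<pi> w)"
    if "u \<in> mspace F" "w \<in> mspace F" for u w
    using n_fibre[OF that] fibreD by auto
  have n_n: "?n u (?n v w) = \<mu> (\<zero> (\<pi> u)) (\<mu> (\<zero> (\<pi> v)) w)"
    if "u \<in> mspace F" "v \<in> mspace F" "w \<in> mspace F" for u v w
  proof -
    have vw: "\<mu> (\<zero> (\<pi> v)) w \<in> E (\<mu>M (\<pi> v) (\<pi> w))"
      by (rule mult_fibre[OF zero_in[OF proj_in[OF that(2)]] fibreI[OF that(3)]])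
    have uvw: "\<mu> (\<zero> (\<pi> u)) (\<mu> (\<zero> (\<pi> v)) w) \<in> E (\<mu>M (\<pi> u) (\<mu>M (\<pi> v) (\<pi> w)))"
      by (rule mult_fibre[OF zero_in[OF proj_in[OF that(1)]] vw])
    show ?thesis
      using vertical_symmetry_eq[OF that(1) n_in[OF that(2,3)]] vertical_symmetry_eq[OF that(2,3)]
        zero_mult_scale[OF proj_in[OF that(1)] vw, of "- 1"] uminus_uminus[OF uvw] by simp
  qed
  have zF: "\<zero> (\<pi> u) \<in> mspace F" if "u \<in> mspace F" for u
    using fibreD(1)[OF zero_in[OF proj_in[OF that]]] .
  have S1: "?n u u = u" if "u \<in> mspace F" for u
    using vertical_symmetry_eq[OF that that] zero_mult_fibre[OF fibreI[OF that]]
      uminus_uminus[OF fibreI[OF that]] by simp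
  have S2: "?n u (?n u w) = w" if "u \<in> mspace F" "w \<in> mspace F" for u w
    using n_n[OF that(1,1,2)] mult_invol[OF zF[OF that(1)] that(2)] by simp
  have S3: "?n u (?n v w) = ?n (?n u v) (?n u w)"
    if "u \<in> mspace F" "v \<in> mspace F" "w \<in> mspace F" for u v w
  proof -
    have "?n (?n u v) (?n u w) = \<mu> (\<zero> (\<mu>M (\<pi> u) (\<pi> v))) (\<mu> (\<zero> (\<pi> u)) w)"
      using n_n[OF n_in[OF that(1,2)] that(1,3)] n_proj[OF that(1,2)] by simp
    also have "\<dots> = \<mu> (\<mu> (\<zero> (\<pi> u)) (\<zero> (\<pi> v))) (\<mu> (\<zero> (\<pi> u)) w)"
      using mult_zero_zero proj_in that by simp
    also have "\<dots> = \<mu> (\<zero> (\<pi> u)) (\<mu> (\<zero> (\<pi> v)) w)"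
      using mult_distrib[OF zF[OF that(1)] zF[OF that(2)] that(3)] by simp
    finally show ?thesis using n_n[OF that] by simp
  qed
  show ?thesis
    unfolding reflection_space_def using manifolds(1) smooth_vertical_symmetry S1 S2 S3 by blast
qed

end

theorem proposition1p8:
  fixes sV :: "'k::dense_unit_ring \<Rightarrow> 'v \<Rightarrow> 'v::{topological_ab_group_add,t2_space}"
    and F :: "('k, 'f, 'g::{topological_ab_group_add,t2_space}) manifold_data"
    and \<mu> :: "'f \<Rightarrow> 'f \<Rightarrow> 'f"
    and M :: "('k, 'm, 'e::{topological_ab_group_add,t2_space}) manifold_data"
    and \<mu>M :: "'m \<Rightarrow> 'm \<Rightarrow> 'm"
    and \<pi> :: "'f \<Rightarrow> 'm"
    and B :: "('k, 'm, 'f) fibre_ops"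
  assumes "symmetric_bundle sV F \<mu> M \<mu>M \<pi> B"
  shows "reflection_space F (vertical_symmetry \<mu> \<pi> B)"
proof -
  interpret symmetric_bundle_space sV F \<mu> M \<mu>M \<pi> B by unfold_locales (rule assms)
  show ?thesis by (rule reflection_space_vertical_symmetry)
qed

end
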